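(* Let $G$ be a rooted directed tree without leaves, with edges $\{e_i : i\in I\}$. Let $\rho=(\rho_i)_{i\in I}$ be a $1$-admissible weight, so that the left translation semigroup $(T_t)_{t\ge0}$ is a strongly continuous semigroup on $L^1_\rho(L(G))$. Let $\mathcal F$ be a proper, finite invariant Furstenberg family on $\mathbb R_+$. For a finite nonempty set $K\subset I$, $\varepsilon>0$ and $0<\alpha<1$, define $$\mathcal N_1(K,\varepsilon,\alpha)=\Bigl\{t\ge0:\ \inf_{E\subset[0,1),\ m(E)>\alpha}\ \int_E\sum_{i\in K}\ \inf_{j\in M_{n(t,s)}(i)}\rho_j(t+s-n(t,s))\,ds<\varepsilon\Bigr\},$$ where the outer infimum is over all Lebesgue measurable subsets $E$ of $[0,1)$ with $m(E)>\alpha$ and $m$ is Lebesgue measure. Then the following assertions are equivalent: (i) $(T_t)_{t\ge0}$ is $\mathcal F$-transitive on $L^1_\rho(L(G))$; (ii) for every finite nonempty set $K\subset I$, every $\varepsilon>0$ and every $0<\alpha<1$, one has $\mathcal N_1(K,\varepsilon,\alpha)\in\mathcal F$; (iii) $(T_t)_{t\ge0}$ is topologically $\mathcal F$-recurrent on $L^1_\rho(L(G))$.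
   Context: **Directed trees.** A directed tree is a directed graph $G=(V,E)$ that is connected (as an undirected graph), contains no cycles, in which every vertex $v$ has at most one parent (at most one $u\in V$ with $(u,v)\in E$), and with $V$ countable. If $(u,v)\in E$, then $u$ is the parent of $v$ and $v$ a child of $u$; $u$ is the tail and $v$ the head of the edge $(u,v)$. A leaf is a vertex without children, a root is a vertex without a parent; $G$ is rooted if it has a root. Write $E=\{e_i:i\in I\}$ with $I$ countable (distinct indices giving distinct edges). For $i\in I$ let $M_0(i)=\{i\}$ and $M_{n+1}(i)=\{j\in I:\text{the head of } e_k \text{ is the tail of } e_j \text{ for some } k\in M_n(i)\}$, $n\in\mathbb N_0$. **Weighted spaces.** The directed metric tree $L(G)$ is obtained by replacing each edge by a copy of $[0,1)$, with coordinate increasing from tail to head. A function on $L(G)$ is identified with a family $f=(f_i)_{i\in I}$, $f_i:[0,1)\to\mathbb K$, where $\mathbb K=\mathbb R$ or $\mathbb C$. A weight is a family $\rho=(\rho_i)_{i\in I}$ with $\rho_i\in L^1([0,1))$ and $\rho_i(s)>0$ for every $s\in[0,1)$. $L^1_\rho(L(G))$ is the Banach space of (classes of a.e. equal) measurable families $f=(f_i)_{i\in I}$ with norm $\|f\|_{1,\rho}=\sum_{i\in I}\int_0^1|f_i(s)|\rho_i(s)\,ds<\infty$. **Left translation semigroup.** For $t\ge0$, $s\in[0,1)$ set $n(t,s)=\lfloor t+s\rfloor$ and $\sigma(t,s)=t+s-n(t,s)\in[0,1)$. For $t\ge 0$, $(T_tf)_i(s)=\sum_{j\in M_{n(t,s)}(i)}f_j(\sigma(t,s))$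 for $i\in I$ and a.e. $s\in[0,1)$ (empty sums are $0$). **Admissibility.** $\rho$ is $1$-admissible if there exist $M\ge1$ and $\omega\in\mathbb R$ such that for every $i\in I$, $t\ge0$, $s\in[0,1)$: $$\rho_i(s)\le Me^{\omega t}\inf_{j\in M_{n(t,s)}(i)}\rho_j(\sigma(t,s)).$$ It is known that if $\rho$ is $1$-admissible, then $(T_t)_{t\ge0}$ is a strongly continuous semigroup of bounded linear operators on $L^1_\rho(L(G))$ with $\|T_t\|\le Me^{\omega t}$. **Furstenberg families.** A Furstenberg family on $\mathbb R_+=[0,\infty)$ is a nonempty collection $\mathcal F$ of subsets of $\mathbb R_+$ such that $A\in\mathcal F$ and $A\subset B\subset\mathbb R_+$ imply $B\in\mathcal F$. It is proper if $\varnothing\notin\mathcal F$ (and $\mathcal F\ne\varnothing$), and finite invariant if $A\in\mathcal F$, $R>0$ imply $A\cap(R,\infty)\in\mathcal F$. For a semigroup $(T_t)_{t\ge0}$ on $X$ and nonempty open $U,V\subset X$, let $N(U,V)=\{t\ge0:T_t(U)\cap V\ne\varnothing\}$. The semigroup is $\mathcal F$-transitive if $N(U,V)\in\mathcal F$ for all nonempty open $U,V\subset X$, and topologically $\mathcal F$-recurrent if $N(U,U)\in\mathcal F$ for every nonempty open $U\subset X$. *)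

theory Defs
  imports "Graph_Theory.Digraph_Component" "HOL-Analysis.Analysis"
begin

section \<open>Directed trees\<close>

text \<open>
  The family of edges is the family of arcs: the index set is \<^term>\<open>arcs G\<close>, and
  \<^locale>\<open>nomulti_digraph\<close> says that distinct indices give distinct edges.
  The predicate \<^const>\<open>tree\<close> says that the graph is connected as an undirected graph (in particular
  nonempty) and that it has no directed cycle, where loops and 2-cycles count as cycles. As
  every vertex has at most one parent, this also excludes undirected cycles.
\<close>

locale directed_tree = nomulti_digraph G for G :: "('v, 'i) pre_digraph" (structure) +
  assumes countable_verts: "countable (verts G)"
    and countable_arcs: "countable (arcs G)"
    and tree: "tree G"
    and parent_unique: "u \<rightarrow> v \<Longrightarrow> u' \<rightarrow> v \<Longrightarrow> u = u'"

definition is_root :: "('v, 'i) pre_digraph \<Rightarrow> 'v \<Rightarrow> bool" where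
  "is_root G r \<longleftrightarrow> r \<in> verts G \<and> \<not> (\<exists>u. u \<rightarrow>\<^bsub>G\<^esub> r)"

definition is_leaf :: "('v, 'i) pre_digraph \<Rightarrow> 'v \<Rightarrow> bool" where
  "is_leaf G v \<longleftrightarrow> v \<in> verts G \<and> \<not> (\<exists>w. v \<rightarrow>\<^bsub>G\<^esub> w)"

definition rooted :: "('v, 'i) pre_digraph \<Rightarrow> bool" where
  "rooted G \<longleftrightarrow> (\<exists>r. is_root G r)"

definition leafless :: "('v, 'i) pre_digraph \<Rightarrow> bool" where
  "leafless G \<longleftrightarrow> (\<forall>v. \<not> is_leaf G v)"

primrec descendants :: "('v, 'i) pre_digraph \<Rightarrow> nat \<Rightarrow> 'i \<Rightarrow> 'i set" where
  "descendants G 0 i = {i}"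
| "descendants G (Suc n) i = {j \<in> arcs G. \<exists>k \<in> descendants G n i. head G k = tail G j}"


section \<open>Weighted spaces on the metric tree\<close>

text \<open>
  Functions on the metric tree are families indexed by arcs; their values at other
  indices and outside \<^term>\<open>{0..<1::real}\<close> are irrelevant. Scalars range over a type of class
  \<^class>\<open>real_normed_field\<close> and \<^class>\<open>euclidean_space\<close>; up to isometric isomorphism the only such
  types are the real and the complex numbers.
\<close>

definition weight :: "('v, 'i) pre_digraph \<Rightarrow> ('i \<Rightarrow> real \<Rightarrow> real) \<Rightarrow> bool" where
  "weight G \<rho> \<longleftrightarrow>
    (\<forall>i \<in> arcs G. integrable (lebesgue_on {0..<1}) (\<rho> i) \<and> (\<forall>s \<in> {0..<1}. \<rho> i s > 0))"

definition L1_norm ::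
  "('v, 'i) pre_digraph \<Rightarrow> ('i \<Rightarrow> real \<Rightarrow> real) \<Rightarrow> ('i \<Rightarrow> real \<Rightarrow> 'k::real_normed_vector) \<Rightarrow> ennreal" where
  "L1_norm G \<rho> f =
    (\<integral>\<^sup>+ i. (\<integral>\<^sup>+ s. ennreal (norm (f i s) * \<rho> i s) \<partial>lebesgue_on {0..<1}) \<partial>count_space (arcs G))"

definition L1_fun ::
  "('v, 'i) pre_digraph \<Rightarrow> ('i \<Rightarrow> real \<Rightarrow> real) \<Rightarrow> ('i \<Rightarrow> real \<Rightarrow> 'k::real_normed_vector) set" where
  "L1_fun G \<rho> =
    {f. (\<forall>i \<in> arcs G. f i \<in> borel_measurable (lebesgue_on {0..<1})) \<and> L1_norm G \<rho> f < \<infinity>}"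

definition L1_rel ::
  "('v, 'i) pre_digraph \<Rightarrow> ('i \<Rightarrow> real \<Rightarrow> real) \<Rightarrow> ('i \<Rightarrow> real \<Rightarrow> 'k::real_normed_vector) rel" where
  "L1_rel G \<rho> =
    {(f, g). f \<in> L1_fun G \<rho> \<and> g \<in> L1_fun G \<rho> \<and>
      (\<forall>i \<in> arcs G. AE s in lebesgue_on {0..<1}. f i s = g i s)}"

definition L1_space ::
  "('v, 'i) pre_digraph \<Rightarrow> ('i \<Rightarrow> real \<Rightarrow> real) \<Rightarrow> ('i \<Rightarrow> real \<Rightarrow> 'k::real_normed_vector) set set" where
  "L1_space G \<rho> = L1_fun G \<rho> // L1_rel G \<rho>"

definition L1_dist ::
  "('v, 'i) pre_digraph \<Rightarrow> ('i \<Rightarrow> real \<Rightarrow> real) \<Rightarrow>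
    ('i \<Rightarrow> real \<Rightarrow> 'k::real_normed_vector) set \<Rightarrow> ('i \<Rightarrow> real \<Rightarrow> 'k) set \<Rightarrow> real" where
  "L1_dist G \<rho> A B =
    (let f = (SOME f. f \<in> A); g = (SOME g. g \<in> B)
     in enn2real (L1_norm G \<rho> (\<lambda>i s. f i s - g i s)))"

definition L1_topology ::
  "('v, 'i) pre_digraph \<Rightarrow> ('i \<Rightarrow> real \<Rightarrow> real) \<Rightarrow> ('i \<Rightarrow> real \<Rightarrow> 'k::real_normed_vector) set topology" where
  "L1_topology G \<rho> = Metric_space.mtopology (L1_space G \<rho>) (L1_dist G \<rho>)"


section \<open>The left translation semigroup\<close>

definition shift_index :: "real \<Rightarrow> real \<Rightarrow> nat" where
  "shift_index t s = nat \<lfloor>t + s\<rfloor>"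

definition shift_pos :: "real \<Rightarrow> real \<Rightarrow> real" where
  "shift_pos t s = t + s - real (shift_index t s)"

definition left_translation_fun ::
  "('v, 'i) pre_digraph \<Rightarrow> real \<Rightarrow> ('i \<Rightarrow> real \<Rightarrow> 'k::real_normed_vector) \<Rightarrow> 'i \<Rightarrow> real \<Rightarrow> 'k" where
  "left_translation_fun G t f i s =
    (\<Sum>\<^sub>\<infinity> j \<in> descendants G (shift_index t s) i. f j (shift_pos t s))"

text \<open>
  The induced map on classes. For admissible weights the sets in the union all coincide.
\<close>

definition left_translation ::
  "('v, 'i) pre_digraph \<Rightarrow> ('i \<Rightarrow> real \<Rightarrow> real) \<Rightarrow> real \<Rightarrow>
    ('i \<Rightarrow> real \<Rightarrow> 'k::real_normed_vector) set \<Rightarrow> ('i \<Rightarrow> real \<Rightarrow> 'k) set" where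
  "left_translation G \<rho> t A = (\<Union>f \<in> A. L1_rel G \<rho> `` {left_translation_fun G t f})"

text \<open>
  Infima are taken in \<^typ>\<open>ennreal\<close>, so that the infimum over an empty set is \<^term>\<open>\<infinity> :: ennreal\<close>.
\<close>

definition inf_weight ::
  "('v, 'i) pre_digraph \<Rightarrow> ('i \<Rightarrow> real \<Rightarrow> real) \<Rightarrow> 'i \<Rightarrow> real \<Rightarrow> real \<Rightarrow> ennreal" where
  "inf_weight G \<rho> i t s =
    (INF j \<in> descendants G (shift_index t s) i. ennreal (\<rho> j (shift_pos t s)))"

definition admissible1 :: "('v, 'i) pre_digraph \<Rightarrow> ('i \<Rightarrow> real \<Rightarrow> real) \<Rightarrow> bool" where
  "admissible1 G \<rho> \<longleftrightarrow>
    (\<exists>M \<omega> :: real. M \<ge> 1 \<and>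
      (\<forall>i \<in> arcs G. \<forall>t \<ge> 0. \<forall>s \<in> {0..<1}.
        ennreal (\<rho> i s) \<le> ennreal (M * exp (\<omega> * t)) * inf_weight G \<rho> i t s))"

definition N1 ::
  "('v, 'i) pre_digraph \<Rightarrow> ('i \<Rightarrow> real \<Rightarrow> real) \<Rightarrow> 'i set \<Rightarrow> real \<Rightarrow> real \<Rightarrow> real set" where
  "N1 G \<rho> K \<epsilon> \<alpha> =
    {t. t \<ge> 0 \<and>
      (INF E \<in> {E \<in> sets lebesgue. E \<subseteq> {0..<1} \<and> measure lebesgue E > \<alpha>}.
        \<integral>\<^sup>+ s \<in> E. (\<Sum>i \<in> K. inf_weight G \<rho> i t s) \<partial>lebesgue) < ennreal \<epsilon>}"


section \<open>Furstenberg families and dynamics\<close>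

definition furstenberg_family :: "real set set \<Rightarrow> bool" where
  "furstenberg_family \<F> \<longleftrightarrow>
    \<F> \<noteq> {} \<and> \<F> \<subseteq> Pow {0..} \<and> (\<forall>A \<in> \<F>. \<forall>B. A \<subseteq> B \<and> B \<subseteq> {0..} \<longrightarrow> B \<in> \<F>)"

definition proper_family :: "real set set \<Rightarrow> bool" where
  "proper_family \<F> \<longleftrightarrow> {} \<notin> \<F> \<and> \<F> \<noteq> {}"

definition finite_invariant :: "real set set \<Rightarrow> bool" where
  "finite_invariant \<F> \<longleftrightarrow> (\<forall>A \<in> \<F>. \<forall>R > 0. A \<inter> {R<..} \<in> \<F>)"

definition hitting_times :: "(real \<Rightarrow> 'a \<Rightarrow> 'a) \<Rightarrow> 'a set \<Rightarrow> 'a set \<Rightarrow> real set" where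
  "hitting_times T U V = {t. t \<ge> 0 \<and> T t ` U \<inter> V \<noteq> {}}"

definition family_transitive :: "real set set \<Rightarrow> 'a topology \<Rightarrow> (real \<Rightarrow> 'a \<Rightarrow> 'a) \<Rightarrow> bool" where
  "family_transitive \<F> X T \<longleftrightarrow>
    (\<forall>U V. openin X U \<and> U \<noteq> {} \<and> openin X V \<and> V \<noteq> {} \<longrightarrow> hitting_times T U V \<in> \<F>)"

definition family_recurrent :: "real set set \<Rightarrow> 'a topology \<Rightarrow> (real \<Rightarrow> 'a \<Rightarrow> 'a) \<Rightarrow> bool" where
  "family_recurrent \<F> X T \<longleftrightarrow>
    (\<forall>U. openin X U \<and> U \<noteq> {} \<longrightarrow> hitting_times T U U \<in> \<F>)"

end

theory Submission
  imports Defs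
begin

text \<open>
  If \<open>T\<^sub>t\<close> returns the indicator of a finite edge set \<open>K\<close> close to itself, then on a large set of
  positions \<open>s\<close> the values on the descendants of each edge of \<open>K\<close> add up to at least one half,
  although the total mass there is small; hence the smallest weight among those descendants is
  small. Conversely, if these smallest weights are small on a large set \<open>E\<close>, any bounded \<open>v\<close>
  supported on \<open>K\<close> and \<open>E\<close> has a preimage under \<open>T\<^sub>t\<close> of small norm, obtained by placing its values on
  a measurably chosen descendant of nearly minimal weight. Adding this preimage to a finitely
  supported \<open>u\<close>, which \<open>T\<^sub>t\<close> annihilates for large \<open>t\<close> because every edge of a rooted tree has finite
  depth, yields a point near \<open>u\<close> that is mapped near \<open>v\<close>.
\<close>

text \<open>For each finite edge set the recurrence argument uses only balls around one function,
  which is why recurrence is already as strong as transitivity. The mass that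
  \<open>T\<^sub>t\<close> collects from descendants of \<open>K\<close> is small because, beyond a
  time R governed by the depths of the edges in \<open>K\<close>, these descendants lie outside
  \<open>K\<close>, where the indicator vanishes. Both nontrivial implications are proved only for t
  > R; finite invariance of the family makes that enough. The set of discarded positions has two
  sources: an L1 estimate controls values only off a small set, and a weight is positive but need
  not be bounded away from 0. For fixed t positions move by a rotation of [0,1), which preserves
  Lebesgue measure, so integrals taken along \<open>T\<^sub>t\<close> compare directly with norms.
  An infimum over a generation need not be attained. A slack \<eta> per edge of \<open>K\<close>
  pays for a choice of nearly optimal descendants, and an enumeration of the arcs makes this choice
  measurable.\<close>

abbreviation unit_leb :: "real measure" where
  "unit_leb \<equiv> lebesgue_on {0..<1}"

lemma sets_unit_leb: "A \<in> sets unit_leb \<longleftrightarrow> A \<in> sets lebesgue \<and> A \<subseteq> {0..<1}"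
  by (auto simp: sets_restrict_space_iff)

lemma emeasure_unit_leb: "A \<in> sets unit_leb \<Longrightarrow> emeasure unit_leb A = emeasure lebesgue A"
  by (subst emeasure_restrict_space) (auto simp: sets_unit_leb)

lemma finite_measure_unit_leb: "finite_measure unit_leb"
  by (rule finite_measure_lebesgue_on) (simp add: lmeasurable_iff_integrable)

lemma measure_unit_leb: "A \<in> sets unit_leb \<Longrightarrow> measure unit_leb A = measure lebesgue A"
  by (simp add: measure_def emeasure_unit_leb)

lemma measure_unit_leb_Compl:
  "A \<in> sets unit_leb \<Longrightarrow> measure unit_leb ({0..<1} - A) = 1 - measure unit_leb A"
  using finite_measure.finite_measure_compl[OF finite_measure_unit_leb, of A]
  by (simp add: measure_unit_leb sets_unit_leb)

lemma nn_integral_unit_leb: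
  "(\<integral>\<^sup>+s. f s \<partial>unit_leb) = (\<integral>\<^sup>+s. f s * indicator {0..<1} s \<partial>lebesgue)"
  by (subst nn_integral_restrict_space) auto

lemma borel_measurable_unit_leb_iff:
  fixes f :: "real \<Rightarrow> 'b::{topological_space, zero}"
  shows "f \<in> borel_measurable unit_leb \<longleftrightarrow>
    (\<lambda>s. if s \<in> {0..<1} then f s else 0) \<in> borel_measurable lebesgue"
  by (rule measurable_restrict_space_iff) auto

text \<open>Lebesgue measure is complete. This is what makes the translate of an arbitrary
  representative measurable once it agrees almost everywhere with a measurable function.\<close>

lemma measurable_unit_leb_AE:
  fixes f g :: "real \<Rightarrow> 'b::euclidean_space"
  assumes "f \<in> borel_measurable unit_leb" and "AE s in unit_leb. f s = g s"
  shows "g \<in> borel_measurable unit_leb"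
proof -
  have "(\<lambda>s. if s \<in> {0..<1} then f s else 0) \<in> borel_measurable lebesgue"
    using assms(1) by (simp only: borel_measurable_unit_leb_iff)
  moreover have "AE s in lebesgue. (if s \<in> {0..<1} then f s else 0) = (if s \<in> {0..<1} then g s else 0)"
    using assms(2) by (auto simp: AE_restrict_space_iff)
  ultimately have "(\<lambda>s. if s \<in> {0..<1} then g s else 0) \<in> borel_measurable lebesgue"
    by (rule borel_measurable_AE)
  then show ?thesis
    by (simp only: borel_measurable_unit_leb_iff)
qed

section \<open>Motion of positions: rotation of the unit interval\<close>

definition rotation :: "real \<Rightarrow> real \<Rightarrow> real" where
  "rotation c s = frac (s + c)"

lemma rotation_in: "rotation c s \<in> {0..<1}"
  by (simp add: rotation_def frac_lt_1)

text \<open>The angle ranges over all reals precisely for this inverse: \<open>shift_pos\<close>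
  agrees with \<open>rotation\<close> for nonnegative arguments, but \<open>nat\<close> in
  \<open>shift_index\<close> spoils it for negative times.\<close>

lemma rotation_inverse: "s \<in> {0..<1} \<Longrightarrow> rotation (- c) (rotation c s) = s"
proof -
  assume s: "s \<in> {0..<1}"
  have "\<lfloor>s - of_int \<lfloor>s + c\<rfloor>\<rfloor> = - \<lfloor>s + c\<rfloor>"
    using s by (subst floor_diff_of_int) (simp add: floor_eq_iff)
  moreover have "rotation c s + - c = s - of_int \<lfloor>s + c\<rfloor>"
    by (simp add: rotation_def frac_def)
  ultimately show ?thesis
    by (simp add: rotation_def[of "- c"] frac_def)
qed

lemma rotation_eq:
  assumes "s \<in> {0..<1}"
  shows "rotation c s = (if s < 1 - frac c then s + frac c else s + frac c - 1)"
proof -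
  have "frac s = s"
    using assms by (simp add: frac_eq)
  then show ?thesis
    by (auto simp: rotation_def frac_add)
qed

text \<open>The target carries all Lebesgue sets, so Borel measurability of \<open>frac\<close> does
  not suffice. The preimage is cut at the jump into two translates of Lebesgue sets.\<close>

lemma rotation_measurable [measurable]: "rotation c \<in> measurable unit_leb unit_leb"
proof (rule measurableI)
  fix A assume A: "A \<in> sets unit_leb"
  define d where "d = frac c"
  have d: "0 \<le> d" "d < 1"
    by (auto simp: d_def frac_lt_1)
  have "rotation c -` A \<inter> space unit_leb
      = (+) (- d) ` (A \<inter> {d..<1}) \<union> (+) (1 - d) ` (A \<inter> {0..<d})" (is "?L = ?R")
  proof
    show "?L \<subseteq> ?R"
    proof
      fix s assume "s \<in> ?L"
      then have s: "s \<in> {0..<1}" "rotation c s \<in> A"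
        by auto
      show "s \<in> ?R"
      proof (cases "s < 1 - d")
        case True
        then have "s + d \<in> A \<inter> {d..<1}" using s rotation_eq[OF s(1), of c] by (auto simp: d_def)
        moreover have "s = - d + (s + d)" by simp
        ultimately show ?thesis by blast
      next
        case False
        then have "s + d - 1 \<in> A \<inter> {0..<d}" using s rotation_eq[OF s(1), of c] by (auto simp: d_def)
        moreover have "s = (1 - d) + (s + d - 1)" by simp
        ultimately show ?thesis by blast
      qed
    qed
    show "?R \<subseteq> ?L"
      using d by (auto simp: rotation_eq d_def[symmetric])
  qed
  moreover have "A \<in> sets lebesgue"
    using A by (simp add: sets_unit_leb)
  ultimately show "rotation c -` A \<inter> space unit_leb \<in> sets unit_leb"
    using d by (simp only: sets_unit_leb) (intro conjI sets.Un lebesgue_sets_translation sets.Int; auto)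
qed (use rotation_in in auto)

lemma nn_integral_rotation:
  assumes f: "f \<in> borel_measurable unit_leb"
  shows "(\<integral>\<^sup>+s. f (rotation c s) \<partial>unit_leb) = (\<integral>\<^sup>+s. f s \<partial>unit_leb)"
proof -
  define d where "d = frac c"
  have d: "0 \<le> d" "d < 1"
    by (auto simp: d_def frac_lt_1)
  define g where "g = (\<lambda>s. if s \<in> {0..<1} then f s else 0)"
  have g[measurable]: "g \<in> borel_measurable lebesgue"
    using f by (simp only: g_def borel_measurable_unit_leb_iff)
  \<comment> \<open>The split is on the target side: points of [d,1) are reached by translation by
    d, points of [0,d) by translation by d - 1.\<close>
  define g1 where "g1 = (\<lambda>s. g s * indicator {d..<1} s)"
  define g2 where "g2 = (\<lambda>s. g s * indicator {0..<d} s)"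
  have [measurable]: "g1 \<in> borel_measurable lebesgue" "g2 \<in> borel_measurable lebesgue"
    unfolding g1_def g2_def by (intro borel_measurable_times_ennreal borel_measurable_indicator g; simp)+
  have shift: "(\<lambda>s. h (a + s)) \<in> borel_measurable lebesgue"
    "(\<integral>\<^sup>+s. h (a + s) \<partial>lebesgue) = (\<integral>\<^sup>+s. h s \<partial>lebesgue)"
    if [measurable]: "h \<in> borel_measurable lebesgue" for h :: "real \<Rightarrow> ennreal" and a
  proof -
    have "(\<lambda>s. a + 1 * s) \<in> measurable lebesgue lebesgue"
      using lebesgue_affine_measurable[where c = "\<lambda>_::real. 1" and t = a] by simp
    from measurable_compose[OF this that] show "(\<lambda>s. h (a + s)) \<in> borel_measurable lebesgue"
      by simp
    show "(\<integral>\<^sup>+s. h (a + s) \<partial>lebesgue) = (\<integral>\<^sup>+s. h s \<partial>lebesgue)"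
      using nn_integral_real_affine_lebesgue[OF that, of 1 a] by simp
  qed
  have "(\<integral>\<^sup>+s. f (rotation c s) \<partial>unit_leb) = (\<integral>\<^sup>+s. g1 (d + s) + g2 (d - 1 + s) \<partial>lebesgue)"
    unfolding nn_integral_unit_leb
  proof (rule nn_integral_cong)
    fix s :: real
    show "f (rotation c s) * indicator {0..<1} s = g1 (d + s) + g2 (d - 1 + s)"
      using d rotation_eq[of s c]
      by (auto simp: g1_def g2_def g_def d_def[symmetric] algebra_simps split: split_indicator)
  qed
  also have "\<dots> = (\<integral>\<^sup>+s. g1 s \<partial>lebesgue) + (\<integral>\<^sup>+s. g2 s \<partial>lebesgue)"
    by (subst nn_integral_add) (auto simp: shift)
  also have "\<dots> = (\<integral>\<^sup>+s. g1 s + g2 s \<partial>lebesgue)"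
    by (subst nn_integral_add) auto
  also have "\<dots> = (\<integral>\<^sup>+s. f s \<partial>unit_leb)"
    unfolding nn_integral_unit_leb
    by (rule nn_integral_cong) (use d in \<open>auto simp: g1_def g2_def g_def split: split_indicator\<close>)
  finally show ?thesis .
qed

text \<open>The preimage of a null set is null, seen by integrating its indicator along the
  rotation.\<close>

lemma AE_rotation:
  assumes "AE s in unit_leb. P s"
  shows "AE s in unit_leb. P (rotation c s)"
proof -
  obtain N where N: "N \<in> null_sets unit_leb" "{s \<in> space unit_leb. \<not> P s} \<subseteq> N"
    using assms unfolding eventually_ae_filter by blast
  have [measurable]: "N \<in> sets unit_leb" using N by auto
  have "(\<integral>\<^sup>+s. indicator N (rotation c s) \<partial>unit_leb) = 0"
    using N by (subst nn_integral_rotation) auto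
  then have "AE s in unit_leb. indicator N (rotation c s) = (0::ennreal)"
    by (subst (asm) nn_integral_0_iff_AE) auto
  then show ?thesis
    by eventually_elim (use N(2) rotation_in[of c] in \<open>auto simp: indicator_eq_0_iff\<close>)
qed

lemma shift_pos_eq:
  assumes "0 \<le> t" "0 \<le> s"
  shows "shift_pos t s = rotation t s"
  using assms by (simp add: shift_pos_def shift_index_def rotation_def frac_def add.commute)

lemma shift_index_measurable [measurable]: "shift_index t \<in> measurable unit_leb (count_space UNIV)"
proof -
  have "shift_index t \<in> measurable borel (count_space UNIV)"
    unfolding shift_index_def by measurable
  then show ?thesis
    by (intro measurable_restrict_space1 measurable_completion) simp
qed

lemma shift_index_ge: "0 \<le> t \<Longrightarrow> 0 \<le> s \<Longrightarrow> real n \<le> t \<Longrightarrow> n \<le> shift_index t s"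
  unfolding shift_index_def by (simp add: le_nat_floor)

section \<open>Generations of edges in a rooted tree\<close>

context directed_tree
begin

lemma descendants_subset: "i \<in> arcs G \<Longrightarrow> descendants G n i \<subseteq> arcs G"
  by (cases n) auto

text \<open>Uniqueness of the parent fixes the tail, and absence of parallel arcs then fixes the
  arc; hence going back along the tree is deterministic.\<close>

lemma arc_eq_if_head_eq:
  assumes "e \<in> arcs G" "e' \<in> arcs G" "head G e = head G e'"
  shows "e = e'"
proof -
  have "tail G e \<rightarrow> head G e" "tail G e' \<rightarrow> head G e"
    using assms by (metis in_arcs_imp_in_arcs_ends)+
  then have "tail G e = tail G e'"
    by (rule parent_unique)
  then show ?thesis
    using assms no_multi_arcs[of e e'] by (simp add: arc_to_ends_def)
qed

text \<open>Going back n steps from k leaves no choice. This lets values of different edges of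
  \<open>K\<close> be placed on their descendants without interference.\<close>

lemma descendants_disjoint:
  assumes "i \<in> arcs G" "i' \<in> arcs G" "k \<in> descendants G n i" "k \<in> descendants G n i'"
  shows "i = i'"
  using assms(3,4)
proof (induction n arbitrary: k)
  case (Suc n)
  then obtain l l' where "l \<in> descendants G n i" "l' \<in> descendants G n i'"
    "head G l = head G l'"
    by auto
  with Suc.IH descendants_subset assms(1,2) show ?case
    by (metis arc_eq_if_head_eq subsetD)
qed simp

text \<open>Consequently \<open>inf_weight\<close> is an infimum over a nonempty set of reals and
  thus finite, which the selection of descendants relies on.\<close>

lemma descendants_nonempty:
  assumes "leafless G" "i \<in> arcs G"
  shows "descendants G n i \<noteq> {}"
proof (induction n)
  case (Suc n)
  then obtain l where l: "l \<in> descendants G n i"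
    by blast
  then have "head G l \<in> verts G"
    using descendants_subset[OF assms(2)] by (meson head_in_verts subsetD)
  then obtain w where "head G l \<rightarrow> w"
    using assms(1) by (auto simp: leafless_def is_leaf_def)
  then obtain j where "j \<in> arcs G" "tail G j = head G l"
    by (auto simp: arcs_ends_def arc_to_ends_def)
  with l show ?case
    by (auto intro!: exI[of _ j] bexI[of _ l])
qed simp

lemma descendants_walk:
  "k \<in> descendants G n i \<Longrightarrow> (head G i, head G k) \<in> arcs_ends G ^^ n"
proof (induction n arbitrary: k)
  case (Suc n)
  then obtain l where "l \<in> descendants G n i" "head G l = tail G k" "k \<in> arcs G"
    by auto
  with Suc.IH[of l] show ?case
    by (metis in_arcs_imp_in_arcs_ends relpow_Suc_I)
qed simp

text \<open>An undirected path is straightened step by step. If it crosses an edge backwards from y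
  to z, then y is not the root, and the last edge of the directed path to y must come from the
  unique parent z, so dropping that edge leads to z.\<close>

lemma root_reaches:
  assumes r: "is_root G r" and v: "v \<in> verts G"
  shows "(r, v) \<in> (arcs_ends G)\<^sup>*"
proof -
  have "r \<rightarrow>\<^sup>*\<^bsub>with_proj (mk_symmetric G)\<^esub> v"
    using tree r v by (auto simp: tree_def connected_def strongly_connected_def is_root_def mk_symmetric_def)
  then have "(r, v) \<in> rtrancl_on (verts (with_proj (mk_symmetric G))) (arcs_ends (with_proj (mk_symmetric G)))"
    by (simp add: reachable_def)
  then show ?thesis
  proof (induction rule: rtrancl_on_induct)
    case (step y z)
    then have "y \<rightarrow> z \<or> z \<rightarrow> y"
      by (auto simp: mk_symmetric_def arcs_ends_def arc_to_ends_def)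
    then show ?case
    proof
      assume "z \<rightarrow> y"
      with r have "y \<noteq> r"
        by (auto simp: is_root_def)
      with step.IH obtain x where "(r, x) \<in> (arcs_ends G)\<^sup>*" "x \<rightarrow> y"
        by (metis rtranclE)
      with \<open>z \<rightarrow> y\<close> parent_unique show ?thesis
        by blast
    qed (use step.IH in auto)
  qed simp
qed

text \<open>Traced backwards from v, both walks pass through the same parents, and nothing precedes
  the root.\<close>

lemma walk_length_le_depth:
  assumes "is_root G r" "(r, v) \<in> arcs_ends G ^^ d" "(x, v) \<in> arcs_ends G ^^ n"
  shows "n \<le> d"
  using assms(2,3)
proof (induction d arbitrary: v n)
  case 0
  then show ?case
    using assms(1) by (cases n) (auto simp: is_root_def)
next
  case (Suc d)
  show ?case
  proof (cases n)
    case (Suc m)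
    with Suc.prems obtain y y' where "(r, y) \<in> arcs_ends G ^^ d" "y \<rightarrow> v"
      "(x, y') \<in> arcs_ends G ^^ m" "y' \<rightarrow> v"
      by (meson relpow_Suc_E)
    with Suc.IH[of y m] Suc show ?thesis
      using parent_unique by blast
  qed simp
qed

text \<open>An n-th descendant has depth at least n, whatever the starting edge. The resulting
  \<open>N\<close> is uniform in \<open>i\<close> and is the origin of the time bound R in both
  directions.\<close>

lemma eventually_not_descendants:
  assumes "rooted G" "finite K" "K \<subseteq> arcs G"
  obtains N where "\<And>n i k. N \<le> n \<Longrightarrow> i \<in> arcs G \<Longrightarrow> k \<in> K \<Longrightarrow> k \<notin> descendants G n i"
proof -
  obtain r where r: "is_root G r"
    using assms(1) by (auto simp: rooted_def)
  have "\<exists>d. (r, head G k) \<in> arcs_ends G ^^ d" if "k \<in> K" for k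
    using root_reaches[OF r, of "head G k"] assms(3) that by (auto simp: rtrancl_power)
  then obtain d where d: "\<And>k. k \<in> K \<Longrightarrow> (r, head G k) \<in> arcs_ends G ^^ d k"
    by metis
  \<comment> \<open>\<open>Suc\<close> rules out a walk whose length equals the depth. For empty
    \<open>K\<close> the value of \<open>Max\<close> is unspecified, but the claim is
    vacuous.\<close>
  have "k \<notin> descendants G n i" if "Suc (Max (d ` K)) \<le> n" "k \<in> K" for n i k
  proof
    assume "k \<in> descendants G n i"
    then have "n \<le> d k"
      using walk_length_le_depth[OF r d[OF \<open>k \<in> K\<close>]] descendants_walk by blast
    also have "d k \<le> Max (d ` K)"
      using assms(2) that by simp
    finally show False
      using that by simp
  qed
  then show ?thesis
    using that by blast
qed

end

section \<open>The weighted L1 space as a metric space\<close>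

locale weighted_arcs =
  fixes G :: "('v, 'i) pre_digraph" and \<rho> :: "'i \<Rightarrow> real \<Rightarrow> real"
  assumes countable_arcs: "countable (arcs G)" and weight: "weight G \<rho>"
begin

lemma weight_measurable: "i \<in> arcs G \<Longrightarrow> \<rho> i \<in> borel_measurable unit_leb"
  using weight by (auto simp: weight_def)

lemma weight_pos: "i \<in> arcs G \<Longrightarrow> s \<in> {0..<1} \<Longrightarrow> 0 < \<rho> i s"
  using weight by (auto simp: weight_def)

definition measurable_family :: "('i \<Rightarrow> real \<Rightarrow> 'k::real_normed_vector) \<Rightarrow> bool" where
  "measurable_family f \<longleftrightarrow> (\<forall>i \<in> arcs G. f i \<in> borel_measurable unit_leb)"

lemma measurable_familyD:
  "measurable_family f \<Longrightarrow> i \<in> arcs G \<Longrightarrow> f i \<in> borel_measurable unit_leb"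
  by (simp add: measurable_family_def)

lemma L1_fun_iff: "f \<in> L1_fun G \<rho> \<longleftrightarrow> measurable_family f \<and> L1_norm G \<rho> f < \<infinity>"
  by (simp add: L1_fun_def measurable_family_def)

lemma measurable_family_diff:
  fixes f g :: "'i \<Rightarrow> real \<Rightarrow> 'k::euclidean_space"
  shows "measurable_family f \<Longrightarrow> measurable_family g \<Longrightarrow> measurable_family (\<lambda>i s. f i s - g i s)"
  unfolding measurable_family_def by (intro ballI borel_measurable_diff) auto

lemma measurable_family_add:
  fixes f g :: "'i \<Rightarrow> real \<Rightarrow> 'k::euclidean_space"
  shows "measurable_family f \<Longrightarrow> measurable_family g \<Longrightarrow> measurable_family (\<lambda>i s. f i s + g i s)"
  unfolding measurable_family_def by (intro ballI borel_measurable_add) auto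

lemma density_measurable:
  fixes f :: "'i \<Rightarrow> real \<Rightarrow> 'k::euclidean_space"
  shows "measurable_family f \<Longrightarrow> i \<in> arcs G \<Longrightarrow>
    (\<lambda>s. ennreal (norm (f i s) * \<rho> i s)) \<in> borel_measurable unit_leb"
  by (intro measurable_compose[OF _ measurable_ennreal] borel_measurable_times
      measurable_compose[OF _ borel_measurable_norm] measurable_familyD[of f] weight_measurable)

lemma L1_norm_mono:
  assumes "\<And>i s. i \<in> arcs G \<Longrightarrow> s \<in> {0..<1} \<Longrightarrow> norm (f i s) \<le> norm (g i s)"
  shows "L1_norm G \<rho> f \<le> L1_norm G \<rho> g"
  unfolding L1_norm_def using assms weight_pos
  by (intro nn_integral_mono ennreal_leI mult_right_mono) (auto intro: less_imp_le)

lemma L1_norm_cong_AE: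
  assumes "\<And>i. i \<in> arcs G \<Longrightarrow> AE s in unit_leb. norm (f i s) = norm (g i s)"
  shows "L1_norm G \<rho> f = L1_norm G \<rho> g"
  unfolding L1_norm_def
proof (rule nn_integral_cong, rule nn_integral_cong_AE)
  fix i assume "i \<in> space (count_space (arcs G))"
  then show "AE s in unit_leb. ennreal (norm (f i s) * \<rho> i s) = ennreal (norm (g i s) * \<rho> i s)"
    using assms[of i] by auto
qed

lemma L1_norm_add_le:
  fixes f g :: "'i \<Rightarrow> real \<Rightarrow> 'k::euclidean_space"
  assumes f: "measurable_family f" and g: "measurable_family g"
  shows "L1_norm G \<rho> (\<lambda>i s. f i s + g i s) \<le> L1_norm G \<rho> f + L1_norm G \<rho> g"
proof -
  have "L1_norm G \<rho> (\<lambda>i s. f i s + g i s)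
      \<le> (\<integral>\<^sup>+ i. (\<integral>\<^sup>+ s. ennreal (norm (f i s) * \<rho> i s) + ennreal (norm (g i s) * \<rho> i s) \<partial>unit_leb)
          \<partial>count_space (arcs G))"
    unfolding L1_norm_def
  proof (intro nn_integral_mono)
    fix i s assume "i \<in> space (count_space (arcs G))" "s \<in> space unit_leb"
    then have "0 < \<rho> i s"
      using weight_pos by auto
    then have "norm (f i s + g i s) * \<rho> i s \<le> norm (f i s) * \<rho> i s + norm (g i s) * \<rho> i s"
      using norm_triangle_ineq[of "f i s" "g i s"]
      by (metis distrib_right less_imp_le mult_right_mono)
    then show "ennreal (norm (f i s + g i s) * \<rho> i s)
        \<le> ennreal (norm (f i s) * \<rho> i s) + ennreal (norm (g i s) * \<rho> i s)"
      using \<open>0 < \<rho> i s\<close> by (simp flip: ennreal_plus add: ennreal_leI)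
  qed
  also have "\<dots> = (\<integral>\<^sup>+ i. (\<integral>\<^sup>+ s. ennreal (norm (f i s) * \<rho> i s) \<partial>unit_leb)
      + (\<integral>\<^sup>+ s. ennreal (norm (g i s) * \<rho> i s) \<partial>unit_leb) \<partial>count_space (arcs G))"
    using f g by (intro nn_integral_cong nn_integral_add density_measurable) auto
  also have "\<dots> = L1_norm G \<rho> f + L1_norm G \<rho> g"
    unfolding L1_norm_def by (rule nn_integral_add) auto
  finally show ?thesis .
qed

lemma L1_norm_triangle:
  fixes f g h :: "'i \<Rightarrow> real \<Rightarrow> 'k::euclidean_space"
  assumes "measurable_family f" "measurable_family g" "measurable_family h"
  shows "L1_norm G \<rho> (\<lambda>i s. f i s - h i s)
    \<le> L1_norm G \<rho> (\<lambda>i s. f i s - g i s) + L1_norm G \<rho> (\<lambda>i s. g i s - h i s)"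
  using L1_norm_add_le[OF measurable_family_diff[OF assms(1,2)] measurable_family_diff[OF assms(2,3)]]
  by simp

lemma L1_norm_commute:
  fixes f g :: "'i \<Rightarrow> real \<Rightarrow> 'k::real_normed_vector"
  shows "L1_norm G \<rho> (\<lambda>i s. f i s - g i s) = L1_norm G \<rho> (\<lambda>i s. g i s - f i s)"
  by (intro L1_norm_cong_AE) (simp add: norm_minus_commute)

lemma L1_fun_add:
  fixes f g :: "'i \<Rightarrow> real \<Rightarrow> 'k::euclidean_space"
  assumes "f \<in> L1_fun G \<rho>" "g \<in> L1_fun G \<rho>"
  shows "(\<lambda>i s. f i s + g i s) \<in> L1_fun G \<rho>"
  using assms L1_norm_add_le[of f g]
  by (auto simp: L1_fun_iff measurable_family_add intro: le_less_trans)

lemma L1_fun_diff: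
  fixes f g :: "'i \<Rightarrow> real \<Rightarrow> 'k::euclidean_space"
  assumes "f \<in> L1_fun G \<rho>" "g \<in> L1_fun G \<rho>"
  shows "(\<lambda>i s. f i s - g i s) \<in> L1_fun G \<rho>"
proof -
  have "L1_norm G \<rho> (\<lambda>i s. - g i s) = L1_norm G \<rho> g"
    by (intro L1_norm_cong_AE) simp
  then have "(\<lambda>i s. - g i s) \<in> L1_fun G \<rho>"
    using assms(2) by (simp add: L1_fun_iff measurable_family_def)
  from L1_fun_add[OF assms(1) this] show ?thesis
    by simp
qed

text \<open>Strict positivity of the weights allows them to be cancelled; this gives the separation
  axiom of the metric.\<close>

lemma L1_norm_eq_0_iff:
  fixes f :: "'i \<Rightarrow> real \<Rightarrow> 'k::euclidean_space"
  assumes "measurable_family f"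
  shows "L1_norm G \<rho> f = 0 \<longleftrightarrow> (\<forall>i \<in> arcs G. AE s in unit_leb. f i s = 0)"
proof -
  have "L1_norm G \<rho> f = 0 \<longleftrightarrow>
      (\<forall>i \<in> arcs G. (\<integral>\<^sup>+ s. ennreal (norm (f i s) * \<rho> i s) \<partial>unit_leb) = 0)"
    unfolding L1_norm_def by (subst nn_integral_0_iff_AE) (auto simp: AE_count_space)
  also have "\<dots> \<longleftrightarrow> (\<forall>i \<in> arcs G. AE s in unit_leb. ennreal (norm (f i s) * \<rho> i s) = 0)"
    by (intro ball_cong refl nn_integral_0_iff_AE density_measurable assms)
  also have "\<dots> \<longleftrightarrow> (\<forall>i \<in> arcs G. AE s in unit_leb. f i s = 0)"
  proof (intro ball_cong refl AE_cong)
    fix i s assume "i \<in> arcs G" "s \<in> space unit_leb"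
    then have "0 < \<rho> i s"
      using weight_pos by auto
    then show "(ennreal (norm (f i s) * \<rho> i s) = 0) = (f i s = 0)"
      by (auto simp: ennreal_eq_0_iff mult_le_0_iff)
  qed
  finally show ?thesis .
qed

lemma equiv_L1_rel:
  "equiv (L1_fun G \<rho>) (L1_rel G \<rho> :: ('i \<Rightarrow> real \<Rightarrow> 'k::real_normed_vector) rel)"
proof (rule equivI)
  show "trans (L1_rel G \<rho> :: ('i \<Rightarrow> real \<Rightarrow> 'k) rel)"
  proof (rule transI)
    fix f g h :: "'i \<Rightarrow> real \<Rightarrow> 'k"
    assume fg: "(f, g) \<in> L1_rel G \<rho>" and gh: "(g, h) \<in> L1_rel G \<rho>"
    have "AE s in unit_leb. f i s = h i s" if "i \<in> arcs G" for i
    proof -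
      have "AE s in unit_leb. f i s = g i s" "AE s in unit_leb. g i s = h i s"
        using fg gh that by (auto simp: L1_rel_def)
      then show ?thesis
        by eventually_elim simp
    qed
    with fg gh show "(f, h) \<in> L1_rel G \<rho>"
      by (auto simp: L1_rel_def)
  qed
  show "sym (L1_rel G \<rho> :: ('i \<Rightarrow> real \<Rightarrow> 'k) rel)"
    by (rule symI) (auto simp: L1_rel_def eq_commute)
qed (auto simp: L1_rel_def refl_on_def)

lemma L1_space_representative:
  assumes "A \<in> (L1_space G \<rho> :: ('i \<Rightarrow> real \<Rightarrow> 'k::real_normed_vector) set set)"
  obtains f where "f \<in> L1_fun G \<rho>" "f \<in> A"
proof -
  obtain f where "f \<in> L1_fun G \<rho>" "A = L1_rel G \<rho> `` {f}"
    using assms unfolding L1_space_def by (rule quotientE)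
  then show ?thesis
    using that by (simp add: L1_rel_def)
qed

lemma L1_class_in: "f \<in> L1_fun G \<rho> \<Longrightarrow> L1_rel G \<rho> `` {f} \<in> L1_space G \<rho>"
  by (simp add: L1_space_def quotientI)

lemma L1_class_self: "f \<in> L1_fun G \<rho> \<Longrightarrow> f \<in> L1_rel G \<rho> `` {f}"
  by (simp add: L1_rel_def)

text \<open>\<open>L1_dist\<close> picks representatives by Hilbert choice. Since members of a class
  agree almost everywhere, any convenient representatives may replace them.\<close>

lemma L1_dist_eq:
  fixes f g :: "'i \<Rightarrow> real \<Rightarrow> 'k::real_normed_vector"
  assumes "A \<in> L1_space G \<rho>" "B \<in> L1_space G \<rho>" "f \<in> A" "g \<in> B"
  shows "L1_dist G \<rho> A B = enn2real (L1_norm G \<rho> (\<lambda>i s. f i s - g i s))"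
proof -
  define f' g' where "f' = (SOME f. f \<in> A)" and "g' = (SOME g. g \<in> B)"
  have "f' \<in> A" "g' \<in> B"
    using someI[of "\<lambda>f. f \<in> A", OF assms(3)] someI[of "\<lambda>g. g \<in> B", OF assms(4)]
    by (simp_all add: f'_def g'_def)
  then have rel: "(f', f) \<in> L1_rel G \<rho>" "(g', g) \<in> L1_rel G \<rho>"
    using assms quotient_eq_iff[OF equiv_L1_rel, of A A f' f] quotient_eq_iff[OF equiv_L1_rel, of B B g' g]
    by (simp_all add: L1_space_def)
  have "L1_norm G \<rho> (\<lambda>i s. f' i s - g' i s) = L1_norm G \<rho> (\<lambda>i s. f i s - g i s)"
  proof (rule L1_norm_cong_AE)
    fix i assume "i \<in> arcs G"
    then have "AE s in unit_leb. f' i s = f i s" "AE s in unit_leb. g' i s = g i s"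
      using rel by (auto simp: L1_rel_def)
    then show "AE s in unit_leb. norm (f' i s - g' i s) = norm (f i s - g i s)"
      by eventually_elim simp
  qed
  then show ?thesis
    by (simp add: L1_dist_def f'_def g'_def)
qed

lemma L1_norm_diff_finite:
  fixes f g :: "'i \<Rightarrow> real \<Rightarrow> 'k::euclidean_space"
  assumes "f \<in> L1_fun G \<rho>" "g \<in> L1_fun G \<rho>"
  shows "L1_norm G \<rho> (\<lambda>i s. f i s - g i s) < top"
  using L1_fun_diff[OF assms] by (simp add: L1_fun_iff)

lemma L1_space_subset: "A \<in> L1_space G \<rho> \<Longrightarrow> f \<in> A \<Longrightarrow> f \<in> L1_fun G \<rho>"
  using in_quotient_imp_subset[OF equiv_L1_rel, of A] by (auto simp: L1_space_def)

text \<open>\<open>enn2real\<close> sends infinity to 0, so the comparison rests on finiteness of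
  the norm of a difference of members of the space.\<close>

lemma L1_dist_less_iff:
  fixes f g :: "'i \<Rightarrow> real \<Rightarrow> 'k::euclidean_space"
  assumes "A \<in> L1_space G \<rho>" "B \<in> L1_space G \<rho>" "f \<in> A" "g \<in> B"
  shows "L1_dist G \<rho> A B < r \<longleftrightarrow> L1_norm G \<rho> (\<lambda>i s. f i s - g i s) < ennreal r"
proof -
  have "L1_norm G \<rho> (\<lambda>i s. f i s - g i s) < top"
    using assms by (intro L1_norm_diff_finite L1_space_subset)
  then show ?thesis
    unfolding L1_dist_eq[OF assms]
    by (cases "L1_norm G \<rho> (\<lambda>i s. f i s - g i s)") (auto simp: ennreal_less_iff)
qed

sublocale L1: Metric_space "L1_space G \<rho> :: ('i \<Rightarrow> real \<Rightarrow> 'k::euclidean_space) set set" "L1_dist G \<rho>"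
proof
  fix A B C :: "('i \<Rightarrow> real \<Rightarrow> 'k) set"
  show "0 \<le> L1_dist G \<rho> A B"
    by (simp add: L1_dist_def Let_def)
  show "L1_dist G \<rho> A B = L1_dist G \<rho> B A"
    unfolding L1_dist_def Let_def by (subst L1_norm_commute) simp
  assume A: "A \<in> L1_space G \<rho>" and B: "B \<in> L1_space G \<rho>"
  obtain f g where f: "f \<in> L1_fun G \<rho>" "f \<in> A" and g: "g \<in> L1_fun G \<rho>" "g \<in> B"
    using A B by (meson L1_space_representative)
  have fin: "L1_norm G \<rho> (\<lambda>i s. f i s - g i s) < top"
    using f g by (intro L1_norm_diff_finite)
  have "L1_dist G \<rho> A B = 0 \<longleftrightarrow> L1_norm G \<rho> (\<lambda>i s. f i s - g i s) = 0"
    using fin unfolding L1_dist_eq[OF A B f(2) g(2)] by (auto simp: enn2real_eq_0_iff)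
  also have "\<dots> \<longleftrightarrow> (f, g) \<in> L1_rel G \<rho>"
    using f g by (subst L1_norm_eq_0_iff) (auto simp: L1_rel_def L1_fun_iff measurable_family_diff)
  also have "\<dots> \<longleftrightarrow> A = B"
    using A B f g quotient_eq_iff[OF equiv_L1_rel, of A B f g] by (simp add: L1_space_def)
  finally show "L1_dist G \<rho> A B = 0 \<longleftrightarrow> A = B" .
  assume C: "C \<in> L1_space G \<rho>"
  obtain h where h: "h \<in> L1_fun G \<rho>" "h \<in> C"
    using C by (meson L1_space_representative)
  have fin': "L1_norm G \<rho> (\<lambda>i s. g i s - h i s) < top"
    using g h by (intro L1_norm_diff_finite)
  have "L1_norm G \<rho> (\<lambda>i s. f i s - h i s)
      \<le> L1_norm G \<rho> (\<lambda>i s. f i s - g i s) + L1_norm G \<rho> (\<lambda>i s. g i s - h i s)"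
    using f g h by (intro L1_norm_triangle) (auto simp: L1_fun_iff)
  then have "enn2real (L1_norm G \<rho> (\<lambda>i s. f i s - h i s))
      \<le> enn2real (L1_norm G \<rho> (\<lambda>i s. f i s - g i s) + L1_norm G \<rho> (\<lambda>i s. g i s - h i s))"
    using fin fin' by (intro enn2real_mono) auto
  then show "L1_dist G \<rho> A C \<le> L1_dist G \<rho> A B + L1_dist G \<rho> B C"
    using fin fin'
    by (simp add: L1_dist_eq[OF A B f(2) g(2)] L1_dist_eq[OF A C f(2) h(2)]
        L1_dist_eq[OF B C g(2) h(2)] enn2real_plus)
qed

text \<open>Open sets of classes are replaced by norm balls of functions, so that all later
  approximations can be made on representatives.\<close>

lemma openin_L1_topology_ball:
  fixes U :: "('i \<Rightarrow> real \<Rightarrow> 'k::euclidean_space) set set"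
  assumes "openin (L1_topology G \<rho>) U" "U \<noteq> {}"
  obtains f r where "f \<in> L1_fun G \<rho>" "0 < r"
    "\<And>g. g \<in> L1_fun G \<rho> \<Longrightarrow> L1_norm G \<rho> (\<lambda>i s. f i s - g i s) < ennreal r \<Longrightarrow>
      L1_rel G \<rho> `` {g} \<in> U"
proof -
  obtain A where "A \<in> U"
    using assms(2) by blast
  moreover have "U \<subseteq> L1_space G \<rho>" "\<forall>A. A \<in> U \<longrightarrow> (\<exists>r>0. L1.mball A r \<subseteq> U)"
    using assms(1) unfolding L1_topology_def L1.openin_mtopology by simp_all
  ultimately obtain r where A: "A \<in> L1_space G \<rho>" and r: "0 < r" "L1.mball A r \<subseteq> U"
    by (meson subsetD)
  obtain f where f: "f \<in> L1_fun G \<rho>" "f \<in> A"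
    using A by (rule L1_space_representative)
  have "L1_rel G \<rho> `` {g} \<in> U"
    if "g \<in> L1_fun G \<rho>" "L1_norm G \<rho> (\<lambda>i s. f i s - g i s) < ennreal r" for g
  proof -
    have "L1_rel G \<rho> `` {g} \<in> L1.mball A r"
      using that(2) A L1_class_in[OF that(1)]
        L1_dist_less_iff[OF A L1_class_in[OF that(1)] f(2) L1_class_self[OF that(1)], of r]
      by simp
    with r(2) show ?thesis
      by (rule subsetD)
  qed
  then show ?thesis
    by (rule that[OF f(1) r(1)])
qed

text \<open>Truncation to finitely many edges and to bounded values, with dominated convergence
  applied first on each edge and then over the edges. Two bounds are kept because they serve
  different ends: the one on \<open>norm (u i s)\<close> limits the cost of moving values to other
  edges, the one including the weight limits the loss on a set of small measure, where
  \<open>\<rho> i\<close> may be unbounded.\<close>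

lemma L1_fun_approx:
  fixes f :: "'i \<Rightarrow> real \<Rightarrow> 'k::euclidean_space"
  assumes f: "f \<in> L1_fun G \<rho>" and r: "0 < r"
  obtains u K c where "u \<in> L1_fun G \<rho>" "finite K" "K \<subseteq> arcs G" "0 < c"
    "\<And>i s. i \<notin> K \<Longrightarrow> u i s = 0"
    "\<And>i s. norm (u i s) \<le> c" "\<And>i s. norm (u i s) * \<rho> i s \<le> c"
    "L1_norm G \<rho> (\<lambda>i s. f i s - u i s) < ennreal r"
proof -
  define K where "K n = {i \<in> arcs G. to_nat_on (arcs G) i < n}" for n
  define u where "u n i s = (if i \<in> K n \<and> norm (f i s) \<le> real n \<and> norm (f i s) * \<rho> i s \<le> real n
    then f i s else 0)" for n i s
  have mf: "measurable_family f"
    using f by (simp add: L1_fun_iff)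
  have mu: "measurable_family (u n)" for n
    unfolding measurable_family_def
  proof
    fix i assume i: "i \<in> arcs G"
    note [measurable] = measurable_familyD[OF mf i] weight_measurable[OF i]
    show "u n i \<in> borel_measurable unit_leb"
      unfolding u_def by measurable
  qed
  have fin: "finite (K n)" for n
  proof (rule finite_imageD)
    show "finite (to_nat_on (arcs G) ` K n)"
      by (rule finite_subset[of _ "{..<n}"]) (auto simp: K_def)
    show "inj_on (to_nat_on (arcs G)) (K n)"
      using inj_on_to_nat_on[OF countable_arcs] by (rule inj_on_subset) (auto simp: K_def)
  qed
  define w where "w i = (\<integral>\<^sup>+ s. ennreal (norm (f i s) * \<rho> i s) \<partial>unit_leb)" for i
  have w: "(\<integral>\<^sup>+ i. w i \<partial>count_space (arcs G)) < \<infinity>"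
    using f by (simp add: L1_fun_iff L1_norm_def w_def)
  have le: "ennreal (norm (f i s - u n i s) * \<rho> i s) \<le> ennreal (norm (f i s) * \<rho> i s)"
    if "i \<in> arcs G" "s \<in> {0..<1}" for n i s
    using weight_pos[OF that] by (auto simp: u_def intro!: ennreal_leI)
  have inner: "(\<lambda>n. \<integral>\<^sup>+ s. ennreal (norm (f i s - u n i s) * \<rho> i s) \<partial>unit_leb) \<longlonglongrightarrow> 0"
    if i: "i \<in> arcs G" for i
  proof -
    have "(\<lambda>n. \<integral>\<^sup>+ s. ennreal (norm (f i s - u n i s) * \<rho> i s) \<partial>unit_leb)
        \<longlonglongrightarrow> (\<integral>\<^sup>+ s. 0 \<partial>unit_leb)"
    proof (rule nn_integral_dominated_convergence)
      show "(\<lambda>s. ennreal (norm (f i s) * \<rho> i s)) \<in> borel_measurable unit_leb"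
        by (rule density_measurable[OF mf i])
      show "(\<lambda>s. ennreal (norm (f i s - u n i s) * \<rho> i s)) \<in> borel_measurable unit_leb" for n
        by (rule density_measurable[OF measurable_family_diff[OF mf mu] i])
      show "AE s in unit_leb. ennreal (norm (f i s - u n i s) * \<rho> i s) \<le> ennreal (norm (f i s) * \<rho> i s)" for n
        by (rule AE_I2) (use le[OF i] in simp)
      show "(\<integral>\<^sup>+ s. ennreal (norm (f i s) * \<rho> i s) \<partial>unit_leb) < \<infinity>"
        using nn_integral_ge_point[OF i, of w] w unfolding w_def by (rule le_less_trans)
      show "AE s in unit_leb. (\<lambda>n. ennreal (norm (f i s - u n i s) * \<rho> i s)) \<longlonglongrightarrow> 0"
      proof (rule AE_I2)
        fix s
        obtain m where m: "to_nat_on (arcs G) i < m" "norm (f i s) \<le> real m" "norm (f i s) * \<rho> i s \<le> real m"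
        proof -
          obtain m where "max (real (Suc (to_nat_on (arcs G) i))) (max (norm (f i s)) (norm (f i s) * \<rho> i s)) \<le> real m"
            using real_arch_simple by blast
          then show ?thesis
            by (intro that[of m]) auto
        qed
        have "eventually (\<lambda>n. ennreal (norm (f i s - u n i s) * \<rho> i s) = 0) sequentially"
          using eventually_ge_at_top[of m]
          by eventually_elim (use m i in \<open>auto simp: u_def K_def\<close>)
        then show "(\<lambda>n. ennreal (norm (f i s - u n i s) * \<rho> i s)) \<longlonglongrightarrow> 0"
          by (rule tendsto_eventually)
      qed
    qed simp
    then show ?thesis
      by simp
  qed
  have "(\<lambda>n. L1_norm G \<rho> (\<lambda>i s. f i s - u n i s)) \<longlonglongrightarrow> (\<integral>\<^sup>+ i. 0 \<partial>count_space (arcs G))"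
    unfolding L1_norm_def
    by (rule nn_integral_dominated_convergence[where w = w])
      (use w inner le in \<open>auto simp: AE_count_space w_def intro!: nn_integral_mono\<close>)
  then have "eventually (\<lambda>n. L1_norm G \<rho> (\<lambda>i s. f i s - u n i s) < ennreal r) sequentially"
    using r by (intro order_tendstoD) auto
  then obtain n where n: "L1_norm G \<rho> (\<lambda>i s. f i s - u n i s) < ennreal r"
    by (auto simp: eventually_sequentially)
  \<comment> \<open>\<open>Suc n\<close> instead of \<open>n\<close> makes the common bound positive
    also for n = 0.\<close>
  show ?thesis
  proof (rule that[of "u n" "K n" "real (Suc n)"])
    have "L1_norm G \<rho> (u n) \<le> L1_norm G \<rho> f"
      by (rule L1_norm_mono) (simp add: u_def)
    then show "u n \<in> L1_fun G \<rho>"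
      using f mu by (auto simp: L1_fun_iff intro: le_less_trans)
  qed (use n fin in \<open>auto simp: K_def u_def\<close>)
qed

end

section \<open>Sums over a generation\<close>

lemma nn_integral_count_space_mono_subset:
  assumes "A \<subseteq> B" "\<And>x. x \<in> A \<Longrightarrow> f x \<le> g x"
  shows "(\<integral>\<^sup>+ x. f x \<partial>count_space A) \<le> (\<integral>\<^sup>+ x. g x \<partial>count_space B)"
  using assms
  by (auto simp: nn_integral_count_space_indicator intro!: nn_integral_mono split: split_indicator)

text \<open>If the right-hand side is finite the series converges absolutely, otherwise the bound is
  trivial. It therefore applies to \<open>left_translation_fun\<close> of any representative, at
  every position.\<close>

lemma norm_infsum_le_nn_integral:
  fixes f :: "'a \<Rightarrow> 'b::{banach, second_countable_topology}"
  shows "ennreal (norm (infsum f A)) \<le> (\<integral>\<^sup>+ x. ennreal (norm (f x)) \<partial>count_space A)"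
proof (cases "(\<integral>\<^sup>+ x. ennreal (norm (f x)) \<partial>count_space A) < \<infinity>")
  case True
  have "integrable (count_space A) f"
    using True by (intro integrableI_bounded) auto
  then have "Infinite_Set_Sum.abs_summable_on f A" "Infinite_Set_Sum.abs_summable_on (\<lambda>x. norm (f x)) A"
    by (simp_all add: abs_summable_on_def)
  then have sum: "Infinite_Sum.abs_summable_on (\<lambda>x. norm (f x)) A"
    and "(\<integral>\<^sup>+ x. ennreal (norm (f x)) \<partial>count_space A) = ennreal (infsetsum (\<lambda>x. norm (f x)) A)"
    by (simp_all add: abs_summable_equivalent nn_integral_conv_infsetsum)
  moreover have "infsetsum (\<lambda>x. norm (f x)) A = infsum (\<lambda>x. norm (f x)) A"
    using \<open>Infinite_Set_Sum.abs_summable_on (\<lambda>x. norm (f x)) A\<close> by (rule infsetsum_infsum)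
  moreover have "norm (infsum f A) \<le> infsum (\<lambda>x. norm (f x)) A"
    using sum by (intro norm_infsum_bound) simp
  ultimately show ?thesis
    by (simp add: ennreal_leI)
next
  case False
  then show ?thesis
    by (simp add: less_top[symmetric])
qed

section \<open>Smallest weights along a generation\<close>

locale weighted_tree = directed_tree G + weighted_arcs G \<rho>
  for G :: "('v, 'i) pre_digraph" and \<rho> :: "'i \<Rightarrow> real \<Rightarrow> real"
begin

text \<open>The index set of the infimum varies with s. Giving non-descendants the value
  \<open>top\<close> turns it into an infimum over the fixed countable set of all arcs.\<close>

lemma inf_weight_measurable:
  assumes t: "0 \<le> t" and i: "i \<in> arcs G"
  shows "inf_weight G \<rho> i t \<in> borel_measurable unit_leb"
proof -
  have "(\<lambda>s. INF j\<in>arcs G. if j \<in> descendants G (shift_index t s) i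
      then ennreal (\<rho> j (rotation t s)) else top) \<in> borel_measurable unit_leb"
  proof (intro borel_measurable_INF[OF countable_arcs] measurable_If)
    fix j assume j: "j \<in> arcs G"
    show "(\<lambda>s. ennreal (\<rho> j (rotation t s))) \<in> borel_measurable unit_leb"
      by (intro measurable_compose[OF _ measurable_ennreal]
          measurable_compose[OF rotation_measurable weight_measurable[OF j]])
    have "shift_index t -` {n. j \<in> descendants G n i} \<inter> space unit_leb \<in> sets unit_leb"
      by (rule measurable_sets[OF shift_index_measurable]) simp
    then show "{s \<in> space unit_leb. j \<in> descendants G (shift_index t s) i} \<in> sets unit_leb"
      by (simp add: vimage_def Int_def conj_commute)
  qed simp
  moreover have "(INF j\<in>arcs G. if j \<in> descendants G (shift_index t s) i
      then ennreal (\<rho> j (rotation t s)) else top) = inf_weight G \<rho> i t s"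
    if "s \<in> space unit_leb" for s
  proof (rule antisym)
    show "(INF j\<in>arcs G. if j \<in> descendants G (shift_index t s) i
        then ennreal (\<rho> j (rotation t s)) else top) \<le> inf_weight G \<rho> i t s"
      unfolding inf_weight_def
    proof (rule INF_greatest)
      fix j assume "j \<in> descendants G (shift_index t s) i"
      moreover from this have "j \<in> arcs G"
        using descendants_subset[OF i] by blast
      ultimately show "(INF j\<in>arcs G. if j \<in> descendants G (shift_index t s) i
          then ennreal (\<rho> j (rotation t s)) else top) \<le> ennreal (\<rho> j (shift_pos t s))"
        using t that by (intro INF_lower2[of j]) (auto simp: shift_pos_eq)
    qed
    show "inf_weight G \<rho> i t s \<le> (INF j\<in>arcs G. if j \<in> descendants G (shift_index t s) i
        then ennreal (\<rho> j (rotation t s)) else top)"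
      unfolding inf_weight_def using t that
      by (intro INF_greatest) (auto simp: shift_pos_eq intro!: INF_lower)
  qed
  ultimately show ?thesis
    by (rule measurable_cong[THEN iffD1, rotated])
qed

text \<open>The generation is enlarged to all arcs, where edges of \<open>K\<close> may be given the
  value 0 because they do not occur in it. Sum and integral are then exchanged and each edge is
  rotated back separately.\<close>

lemma rotated_L1_norm_le:
  fixes g :: "'i \<Rightarrow> real \<Rightarrow> 'k::euclidean_space"
  assumes g: "measurable_family g" and i: "i \<in> arcs G"
    and K: "\<And>s. s \<in> {0..<1} \<Longrightarrow> descendants G (shift_index t s) i \<inter> K = {}"
  shows "(\<integral>\<^sup>+ s. (\<integral>\<^sup>+ j. ennreal (norm (g j (rotation t s)) * \<rho> j (rotation t s))
      \<partial>count_space (descendants G (shift_index t s) i)) \<partial>unit_leb)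
    \<le> L1_norm G \<rho> (\<lambda>j s. if j \<in> K then 0 else g j s)"
proof -
  define g' where "g' = (\<lambda>j s. if j \<in> K then 0 else g j s)"
  have g': "measurable_family g'"
    using g by (auto simp: g'_def measurable_family_def)
  define F where "F j s = ennreal (norm (g' j s) * \<rho> j s)" for j s
  have F: "F j \<in> borel_measurable unit_leb" if "j \<in> arcs G" for j
    unfolding F_def by (rule density_measurable[OF g' that])
  have "(\<integral>\<^sup>+ s. (\<integral>\<^sup>+ j. ennreal (norm (g j (rotation t s)) * \<rho> j (rotation t s))
      \<partial>count_space (descendants G (shift_index t s) i)) \<partial>unit_leb)
    \<le> (\<integral>\<^sup>+ s. (\<integral>\<^sup>+ j. F j (rotation t s) \<partial>count_space (arcs G)) \<partial>unit_leb)"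
    using K by (intro nn_integral_mono nn_integral_count_space_mono_subset descendants_subset[OF i])
      (auto simp: F_def g'_def)
  also have "\<dots> = (\<integral>\<^sup>+ j. (\<integral>\<^sup>+ s. F j (rotation t s) \<partial>unit_leb) \<partial>count_space (arcs G))"
    by (rule nn_integral_count_space_nn_integral[OF countable_arcs])
      (rule measurable_compose[OF rotation_measurable F])
  also have "\<dots> = (\<integral>\<^sup>+ j. (\<integral>\<^sup>+ s. F j s \<partial>unit_leb) \<partial>count_space (arcs G))"
    by (intro nn_integral_cong nn_integral_rotation F) simp
  finally show ?thesis
    by (simp add: L1_norm_def F_def g'_def)
qed

text \<open>The absolute values on the descendants sum to at least 1/2. Multiplying by the smallest
  weight and then raising it to the individual weights gives the claim; the factor 2 inverts the
  1/2.\<close>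

lemma inf_weight_le:
  fixes g :: "'i \<Rightarrow> real \<Rightarrow> 'k::euclidean_space"
  assumes t: "0 \<le> t" and s: "s \<in> {0..<1}" and i: "i \<in> arcs G"
    and half: "1 / 2 \<le> norm (left_translation_fun G t g i s)"
  shows "inf_weight G \<rho> i t s \<le> 2 * (\<integral>\<^sup>+ j. ennreal (norm (g j (rotation t s)) * \<rho> j (rotation t s))
      \<partial>count_space (descendants G (shift_index t s) i))"
proof -
  let ?D = "descendants G (shift_index t s) i" and ?w = "inf_weight G \<rho> i t s"
  have pos: "shift_pos t s = rotation t s"
    using t s by (simp add: shift_pos_eq)
  have "ennreal (1 / 2) \<le> ennreal (norm (left_translation_fun G t g i s))"
    using half by (rule ennreal_leI)
  also have "\<dots> \<le> (\<integral>\<^sup>+ j. ennreal (norm (g j (rotation t s))) \<partial>count_space ?D)"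
    unfolding left_translation_fun_def pos by (rule norm_infsum_le_nn_integral)
  finally have *: "ennreal (1 / 2) \<le> (\<integral>\<^sup>+ j. ennreal (norm (g j (rotation t s))) \<partial>count_space ?D)" .
  have "?w = 2 * (ennreal (1 / 2) * ?w)"
  proof -
    have "2 * (ennreal (1 / 2) * ?w) = (ennreal 2 * ennreal (1 / 2)) * ?w"
      by (simp only: mult.assoc ennreal_numeral)
    also have "\<dots> = ?w"
      by (subst ennreal_mult[symmetric]) auto
    finally show ?thesis ..
  qed
  also have "\<dots> \<le> 2 * ((\<integral>\<^sup>+ j. ennreal (norm (g j (rotation t s))) \<partial>count_space ?D) * ?w)"
    by (intro mult_left_mono mult_right_mono *) auto
  also have "\<dots> = 2 * (\<integral>\<^sup>+ j. ennreal (norm (g j (rotation t s))) * ?w \<partial>count_space ?D)"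
    by (subst nn_integral_multc) auto
  also have "\<dots> \<le> 2 * (\<integral>\<^sup>+ j. ennreal (norm (g j (rotation t s)) * \<rho> j (rotation t s)) \<partial>count_space ?D)"
  proof (intro mult_left_mono nn_integral_mono)
    fix j assume j: "j \<in> space (count_space ?D)"
    then have "?w \<le> ennreal (\<rho> j (rotation t s))"
      unfolding inf_weight_def pos by (auto intro: INF_lower)
    moreover have "0 < \<rho> j (rotation t s)"
      using j descendants_subset[OF i] rotation_in by (intro weight_pos) auto
    ultimately show "ennreal (norm (g j (rotation t s))) * ?w
        \<le> ennreal (norm (g j (rotation t s)) * \<rho> j (rotation t s))"
      by (subst ennreal_mult) (auto intro: mult_left_mono)
  qed auto
  finally show ?thesis .
qed

text \<open>For finite \<open>K\<close> the minimum of the weights is positive at each s, so the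
  sets with threshold 1/(n+1) decrease to the empty set and continuity from above applies.\<close>

lemma measure_small_weight:
  assumes K: "finite K" "K \<subseteq> arcs G" and d: "0 < d"
  obtains c where "0 < c" "measure unit_leb {s \<in> {0..<1}. \<exists>i \<in> K. \<rho> i s < c} < d"
proof -
  interpret finite_measure unit_leb
    by (rule finite_measure_unit_leb)
  define F where "F n = {s \<in> {0..<1}. \<exists>i \<in> K. \<rho> i s < 1 / real (Suc n)}" for n
  have "F n \<in> sets unit_leb" for n
  proof -
    have "{s \<in> {0..<1}. \<rho> i s < 1 / real (Suc n)} \<in> sets unit_leb" if "i \<in> K" for i
    proof -
      have "\<rho> i -` {..<1 / real (Suc n)} \<inter> space unit_leb \<in> sets unit_leb"
        using weight_measurable[of i] K that by (intro measurable_sets[of _ _ borel]) auto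
      then show ?thesis
        by (simp add: vimage_def Int_def conj_commute)
    qed
    then have "(\<Union>i\<in>K. {s \<in> {0..<1}. \<rho> i s < 1 / real (Suc n)}) \<in> sets unit_leb"
      using K by (intro sets.finite_UN) auto
    also have "(\<Union>i\<in>K. {s \<in> {0..<1}. \<rho> i s < 1 / real (Suc n)}) = F n"
      by (auto simp: F_def)
    finally show ?thesis .
  qed
  moreover have "decseq F"
  proof (rule decseq_SucI)
    fix n
    have "1 / real (Suc (Suc n)) \<le> 1 / real (Suc n)"
      by (simp add: field_simps)
    then show "F (Suc n) \<subseteq> F n"
      unfolding F_def by (auto intro: less_le_trans)
  qed
  ultimately have "(\<lambda>n. measure unit_leb (F n)) \<longlonglongrightarrow> measure unit_leb (\<Inter>n. F n)"
    by (intro finite_Lim_measure_decseq) auto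
  moreover have "(\<Inter>n. F n) = {}"
  proof (rule ccontr)
    assume "(\<Inter>n. F n) \<noteq> {}"
    then obtain s where s: "\<And>n. s \<in> F n"
      by blast
    then have s01: "s \<in> {0..<1}" and "K \<noteq> {}"
      by (auto simp: F_def)
    have "0 < Min ((\<lambda>i. \<rho> i s) ` K)"
      using K \<open>K \<noteq> {}\<close> weight_pos[OF _ s01] by (subst Min_gr_iff) auto
    then obtain n where "1 / real (Suc n) < Min ((\<lambda>i. \<rho> i s) ` K)"
      using nat_approx_posE by blast
    moreover obtain i where "i \<in> K" "\<rho> i s < 1 / real (Suc n)"
      using s[of n] by (auto simp: F_def)
    moreover have "Min ((\<lambda>i. \<rho> i s) ` K) \<le> \<rho> i s"
      using K \<open>i \<in> K\<close> by simp
    ultimately show False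
      by linarith
  qed
  ultimately have "(\<lambda>n. measure unit_leb (F n)) \<longlonglongrightarrow> 0"
    by simp
  then have "eventually (\<lambda>n. measure unit_leb (F n) < d) sequentially"
    using d by (rule order_tendstoD)
  then obtain n where "measure unit_leb (F n) < d"
    by (auto simp: eventually_sequentially)
  then show ?thesis
    by (intro that[of "1 / real (Suc n)"]) (auto simp: F_def)
qed

section \<open>From small weights to transitivity\<close>

lemma L1_norm_finite_support:
  assumes "finite K" "K \<subseteq> arcs G" "\<And>i s. i \<notin> K \<Longrightarrow> f i s = 0"
  shows "L1_norm G \<rho> f = (\<Sum>i\<in>K. \<integral>\<^sup>+ s. ennreal (norm (f i s) * \<rho> i s) \<partial>unit_leb)"
  unfolding L1_norm_def using assms by (intro nn_integral_count_space') auto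

text \<open>The function \<open>h\<close> carries \<open>v\<close>, cut off outside \<open>E\<close>, to a measurable choice \<open>J\<close> of descendants of
  nearly minimal weight. Descendants of distinct edges at equal depth are distinct, so \<open>T\<^sub>t\<close> undoes
  this exactly.\<close>

lemma transport_along_descendants:
  fixes u v :: "'i \<Rightarrow> real \<Rightarrow> 'k::euclidean_space"
  assumes "leafless G" and K: "finite K" "K \<noteq> {}" "K \<subseteq> arcs G"
    and u: "\<forall>i s. i \<notin> K \<longrightarrow> u i s = 0"
    and v: "measurable_family v" "\<forall>i s. i \<notin> K \<longrightarrow> v i s = 0" "\<And>i s. norm (v i s) \<le> c"
    and t: "0 \<le> t" and E: "E \<in> sets unit_leb" and \<eta>: "0 < \<eta>"
    and off: "\<forall>i \<in> arcs G. \<forall>s \<in> {0..<1}. descendants G (shift_index t s) i \<inter> K = {}"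
  obtains h where "measurable_family h"
    "L1_norm G \<rho> h \<le> ennreal c *
      ((\<integral>\<^sup>+ s \<in> E. (\<Sum>i \<in> K. inf_weight G \<rho> i t s) \<partial>lebesgue) + ennreal (real (card K) * \<eta>))"
    "\<And>i s. i \<in> arcs G \<Longrightarrow> s \<in> {0..<1} \<Longrightarrow>
      left_translation_fun G t (\<lambda>j s. u j s + h j s) i s = (if s \<in> E then v i s else 0)"
proof -
  define D where "D i s = descendants G (shift_index t s) i" for i s
  \<comment> \<open>Indexing the arcs by naturals lets \<open>LEAST\<close> make the choice, which
    keeps it measurable. \<open>K\<close> being nonempty ensures that there are arcs to
    enumerate.\<close>
  define e where "e = from_nat_into (arcs G)"
  have e: "e k \<in> arcs G" for k
    unfolding e_def using K by (intro from_nat_into) auto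
  define Q where "Q i k s \<longleftrightarrow> e k \<in> D i s \<and> ennreal (\<rho> (e k) (rotation t s)) \<le> inf_weight G \<rho> i t s + ennreal \<eta>"
    for i k s
  define J where "J i s = e (LEAST k. Q i k s)" for i s
  have J: "J i s \<in> D i s" "ennreal (\<rho> (J i s) (rotation t s)) \<le> inf_weight G \<rho> i t s + ennreal \<eta>"
    if i: "i \<in> arcs G" and s: "s \<in> {0..<1}" for i s
  proof -
    obtain j0 where j0: "j0 \<in> D i s"
      using descendants_nonempty[OF \<open>leafless G\<close> i] by (auto simp: D_def)
    have "inf_weight G \<rho> i t s \<le> ennreal (\<rho> j0 (shift_pos t s))"
      unfolding inf_weight_def using j0 by (intro INF_lower) (simp add: D_def)
    then have "inf_weight G \<rho> i t s < top"
      by (rule le_less_trans) simp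
    \<comment> \<open>Finiteness of the infimum makes adding \<eta> a strict increase, so some
      descendant falls below the new level.\<close>
    then have "inf_weight G \<rho> i t s < inf_weight G \<rho> i t s + ennreal \<eta>"
      using \<eta> by (cases "inf_weight G \<rho> i t s") (auto simp flip: ennreal_plus simp: ennreal_less_iff)
    then obtain j where j: "j \<in> D i s" "ennreal (\<rho> j (rotation t s)) < inf_weight G \<rho> i t s + ennreal \<eta>"
      using t s unfolding D_def by (subst (asm) (1) inf_weight_def) (auto simp: INF_less_iff shift_pos_eq)
    moreover have "e (to_nat_on (arcs G) j) = j"
      using descendants_subset[OF i] j(1) countable_arcs
      by (simp add: e_def D_def subset_iff from_nat_into_to_nat_on)
    ultimately have "Q i (to_nat_on (arcs G) j) s"
      by (simp add: Q_def)
    then have "Q i (LEAST k. Q i k s) s"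
      by (rule LeastI)
    then show "J i s \<in> D i s" "ennreal (\<rho> (J i s) (rotation t s)) \<le> inf_weight G \<rho> i t s + ennreal \<eta>"
      by (simp_all add: Q_def J_def)
  qed
  have "Measurable.pred unit_leb (Q i k)" if i: "i \<in> arcs G" for i k
  proof -
    have "shift_index t -` {n. e k \<in> descendants G n i} \<inter> space unit_leb \<in> sets unit_leb"
      by (rule measurable_sets[OF shift_index_measurable]) simp
    moreover have "{s \<in> space unit_leb. ennreal (\<rho> (e k) (rotation t s)) \<le> inf_weight G \<rho> i t s + ennreal \<eta>} \<in> sets unit_leb"
      by (intro borel_measurable_le borel_measurable_add inf_weight_measurable t i borel_measurable_const
          measurable_compose[OF _ measurable_ennreal]
          measurable_compose[OF rotation_measurable weight_measurable] e)
    ultimately have "shift_index t -` {n. e k \<in> descendants G n i} \<inter> space unit_leb \<inter>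
      {s \<in> space unit_leb. ennreal (\<rho> (e k) (rotation t s)) \<le> inf_weight G \<rho> i t s + ennreal \<eta>} \<in> sets unit_leb"
      by (rule sets.Int)
    also have "shift_index t -` {n. e k \<in> descendants G n i} \<inter> space unit_leb \<inter>
      {s \<in> space unit_leb. ennreal (\<rho> (e k) (rotation t s)) \<le> inf_weight G \<rho> i t s + ennreal \<eta>}
      = {s \<in> space unit_leb. Q i k s}"
      by (auto simp: Q_def D_def)
    finally show ?thesis
      by (simp only: pred_def)
  qed
  then have mL: "(\<lambda>s. LEAST k. Q i k s) \<in> measurable unit_leb (count_space UNIV)" if "i \<in> arcs G" for i
    using that by (intro measurable_Least)
  define w where "w i j s = (if s \<in> E \<and> J i s = j then v i s else 0)" for i j s
  have mw: "w i j \<in> borel_measurable unit_leb" if i: "i \<in> K" for i j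
  proof -
    have "(\<lambda>s. LEAST k. Q i k s) -` {k. e k = j} \<inter> space unit_leb \<in> sets unit_leb"
      using mL[of i] i K by (intro measurable_sets[of _ _ "count_space UNIV"]) auto
    then have "E \<inter> ((\<lambda>s. LEAST k. Q i k s) -` {k. e k = j} \<inter> space unit_leb) \<in> sets unit_leb"
      using E by (rule sets.Int[rotated])
    also have "E \<inter> ((\<lambda>s. LEAST k. Q i k s) -` {k. e k = j} \<inter> space unit_leb)
        = {s \<in> space unit_leb. s \<in> E \<and> J i s = j}"
      using E by (auto simp: J_def)
    finally show ?thesis
      unfolding w_def using v(1) i K by (intro measurable_If measurable_familyD[of v]) auto
  qed
  \<comment> \<open>Values selected at s must sit at position \<open>rotation t s\<close>, hence the
    inverse rotation of the argument.\<close>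
  define h where "h j x = (\<Sum>i\<in>K. w i j (rotation (- t) x))" for j x
  have mh: "measurable_family h"
    unfolding measurable_family_def h_def
    by (intro ballI borel_measurable_sum measurable_compose[OF rotation_measurable mw])
  have h_rotation: "h j (rotation t s) = (\<Sum>i\<in>K. w i j s)" if "s \<in> {0..<1}" for j s
    unfolding h_def using that by (simp add: rotation_inverse)
  define I where "I s = (\<Sum>i\<in>K. inf_weight G \<rho> i t s)" for s
  have mI: "I \<in> borel_measurable unit_leb"
    unfolding I_def using K t by (intro borel_measurable_sum inf_weight_measurable) auto
  have c0: "0 \<le> c"
    using v(3) norm_ge_zero order_trans by blast
  \<comment> \<open>The norm is rewritten in terms of the starting position s, where at most one
    descendant per edge of \<open>K\<close> contributes.\<close>
  have "L1_norm G \<rho> h = (\<integral>\<^sup>+ j. (\<integral>\<^sup>+ s. ennreal (norm (h j (rotation t s)) * \<rho> j (rotation t s)) \<partial>unit_leb)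
      \<partial>count_space (arcs G))"
    unfolding L1_norm_def
    by (intro nn_integral_cong nn_integral_rotation[symmetric] density_measurable[OF mh]) simp
  also have "\<dots> = (\<integral>\<^sup>+ s. (\<integral>\<^sup>+ j. ennreal (norm (h j (rotation t s)) * \<rho> j (rotation t s)) \<partial>count_space (arcs G))
      \<partial>unit_leb)"
    by (rule nn_integral_count_space_nn_integral[symmetric, OF countable_arcs])
      (rule measurable_compose[OF rotation_measurable density_measurable[OF mh]])
  \<comment> \<open>The slack is charged on all of [0,1), whose measure is 1, and only the infima
    are restricted to \<open>E\<close>.\<close>
  also have "\<dots> \<le> (\<integral>\<^sup>+ s. ennreal c * (I s * indicator E s) + ennreal c * ennreal (real (card K) * \<eta>) \<partial>unit_leb)"
  proof (rule nn_integral_mono)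
    fix s assume "s \<in> space unit_leb"
    then have s: "s \<in> {0..<1}"
      by simp
    have "(\<integral>\<^sup>+ j. ennreal (norm (h j (rotation t s)) * \<rho> j (rotation t s)) \<partial>count_space (arcs G))
        \<le> (\<integral>\<^sup>+ j. (\<Sum>i\<in>K. ennreal (norm (w i j s) * \<rho> j (rotation t s))) \<partial>count_space (arcs G))"
    proof (rule nn_integral_mono)
      fix j assume "j \<in> space (count_space (arcs G))"
      then have \<rho>: "0 \<le> \<rho> j (rotation t s)"
        using weight_pos[OF _ rotation_in] by (simp add: less_imp_le)
      have "norm (h j (rotation t s)) * \<rho> j (rotation t s) \<le> (\<Sum>i\<in>K. norm (w i j s)) * \<rho> j (rotation t s)"
        unfolding h_rotation[OF s] using \<rho> by (intro mult_right_mono norm_sum)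
      then show "ennreal (norm (h j (rotation t s)) * \<rho> j (rotation t s))
          \<le> (\<Sum>i\<in>K. ennreal (norm (w i j s) * \<rho> j (rotation t s)))"
        using \<rho> by (subst sum_ennreal) (auto simp: sum_distrib_right intro!: ennreal_leI)
    qed
    also have "\<dots> = (\<Sum>i\<in>K. \<integral>\<^sup>+ j. ennreal (norm (w i j s) * \<rho> j (rotation t s)) \<partial>count_space (arcs G))"
      by (rule nn_integral_sum) simp
    also have "\<dots> \<le> (\<Sum>i\<in>K. ennreal c * (inf_weight G \<rho> i t s + ennreal \<eta>) * indicator E s)"
    proof (rule sum_mono)
      fix i assume "i \<in> K"
      with K have i: "i \<in> arcs G"
        by blast
      have Ja: "J i s \<in> arcs G"
        using J(1)[OF i s] descendants_subset[OF i] by (auto simp: D_def)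
      have "(\<integral>\<^sup>+ j. ennreal (norm (w i j s) * \<rho> j (rotation t s)) \<partial>count_space (arcs G))
          = (\<Sum>j\<in>{J i s}. ennreal (norm (w i j s) * \<rho> j (rotation t s)))"
        using Ja by (intro nn_integral_count_space') (auto simp: w_def)
      also have "\<dots> \<le> ennreal c * ennreal (\<rho> (J i s) (rotation t s)) * indicator E s"
        using v(3)[of i s] weight_pos[OF Ja rotation_in[of t s]] c0
        by (auto simp: w_def ennreal_mult[symmetric] split: split_indicator
            intro!: ennreal_leI mult_right_mono)
      also have "\<dots> \<le> ennreal c * (inf_weight G \<rho> i t s + ennreal \<eta>) * indicator E s"
        by (intro mult_right_mono mult_left_mono J(2)[OF i s]) auto
      finally show "(\<integral>\<^sup>+ j. ennreal (norm (w i j s) * \<rho> j (rotation t s)) \<partial>count_space (arcs G))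
          \<le> ennreal c * (inf_weight G \<rho> i t s + ennreal \<eta>) * indicator E s" .
    qed
    also have "\<dots> = ennreal c * (I s + (\<Sum>i\<in>K. ennreal \<eta>)) * indicator E s"
      by (simp only: I_def sum.distrib[symmetric] sum_distrib_left sum_distrib_right)
    also have "(\<Sum>i\<in>K. ennreal \<eta>) = ennreal (real (card K) * \<eta>)"
      using \<eta> by (simp add: ennreal_mult ennreal_of_nat_eq_real_of_nat)
    also have "ennreal c * (I s + ennreal (real (card K) * \<eta>)) * indicator E s
        \<le> ennreal c * (I s * indicator E s) + ennreal c * ennreal (real (card K) * \<eta>)"
      by (auto simp: distrib_left split: split_indicator)
    finally show "(\<integral>\<^sup>+ j. ennreal (norm (h j (rotation t s)) * \<rho> j (rotation t s)) \<partial>count_space (arcs G))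
        \<le> ennreal c * (I s * indicator E s) + ennreal c * ennreal (real (card K) * \<eta>)" .
  qed
  also have "\<dots> = ennreal c * (\<integral>\<^sup>+ s. I s * indicator E s \<partial>unit_leb) + ennreal c * ennreal (real (card K) * \<eta>)"
  proof -
    have mIE: "(\<lambda>s. I s * indicator E s) \<in> borel_measurable unit_leb"
      by (intro borel_measurable_times_ennreal mI borel_measurable_indicator E)
    have "emeasure unit_leb (space unit_leb) = 1"
      by (subst emeasure_unit_leb) (auto simp: sets_unit_leb)
    then show ?thesis
      using mIE by (subst nn_integral_add) (auto simp: nn_integral_cmult)
  qed
  also have "(\<integral>\<^sup>+ s. I s * indicator E s \<partial>unit_leb) = (\<integral>\<^sup>+ s \<in> E. (\<Sum>i \<in> K. inf_weight G \<rho> i t s) \<partial>lebesgue)"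
    unfolding nn_integral_unit_leb I_def
    by (rule nn_integral_cong) (use E in \<open>auto simp: sets_unit_leb split: split_indicator\<close>)
  finally have norm_h: "L1_norm G \<rho> h \<le> ennreal c *
      ((\<integral>\<^sup>+ s \<in> E. (\<Sum>i \<in> K. inf_weight G \<rho> i t s) \<partial>lebesgue) + ennreal (real (card K) * \<eta>))"
    by (simp only: distrib_left)
  have "left_translation_fun G t (\<lambda>j s. u j s + h j s) i s = (if s \<in> E then v i s else 0)"
    if i: "i \<in> arcs G" and s: "s \<in> {0..<1}" for i s
  proof -
    have "left_translation_fun G t (\<lambda>j s. u j s + h j s) i s
        = (\<Sum>\<^sub>\<infinity> j\<in>D i s. u j (rotation t s) + h j (rotation t s))"
      using t s by (simp add: left_translation_fun_def D_def shift_pos_eq)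
    also have "\<dots> = (\<Sum>\<^sub>\<infinity> j\<in>D i s. if i \<in> K then w i j s else 0)"
    proof (rule infsum_cong)
      fix j assume j: "j \<in> D i s"
      then have "u j (rotation t s) = 0"
        using off[rule_format, OF i s] by (intro u[rule_format]) (auto simp: D_def)
      \<comment> \<open>A nonzero contribution of i' makes j a descendant of both i' and i in the
        same generation, so i' = i.\<close>
      moreover have "w i' j s = (if i' = i then w i j s else 0)" if "i' \<in> K" for i'
      proof (cases "w i' j s = 0")
        case False
        then have "j \<in> D i' s"
          using J(1)[of i' s] that K s by (auto simp: w_def split: if_splits)
        with j i that K have "i' = i"
          unfolding D_def by (intro descendants_disjoint) auto
        then show ?thesis
          by simp
      qed auto
      then have "(\<Sum>i'\<in>K. w i' j s) = (\<Sum>i'\<in>K. if i' = i then w i j s else 0)"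
        by (rule sum.cong[OF refl])
      then have "(\<Sum>i'\<in>K. w i' j s) = (if i \<in> K then w i j s else 0)"
        using K by simp
      ultimately show "u j (rotation t s) + h j (rotation t s) = (if i \<in> K then w i j s else 0)"
        by (simp add: h_rotation[OF s])
    qed
    also have "\<dots> = (if i \<in> K then w i (J i s) s else 0)"
    proof (cases "i \<in> K")
      case True
      have "(\<Sum>\<^sub>\<infinity> j\<in>D i s. w i j s) = (\<Sum>\<^sub>\<infinity> j\<in>{J i s}. w i j s)"
        using J(1)[OF i s] by (intro infsum_cong_neutral) (auto simp: w_def)
      then show ?thesis
        using True by simp
    qed simp
    also have "\<dots> = (if s \<in> E then v i s else 0)"
      using v(2) by (simp add: w_def)
    finally show ?thesis .
  qed
  with mh norm_h show ?thesis
    by (rule that)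
qed

text \<open>The image is a union over representatives f of the class of x. As there are countably
  many arcs, one null set covers all disagreements of x and f; rotated, it remains null, and outside
  it the sums over descendants coincide. Measurability and finite norm of each translate are
  inherited from y.\<close>

lemma left_translation_class:
  fixes x y :: "'i \<Rightarrow> real \<Rightarrow> 'k::euclidean_space"
  assumes t: "0 \<le> t" and x: "x \<in> L1_fun G \<rho>" and y: "y \<in> L1_fun G \<rho>"
    and xy: "\<And>i s. i \<in> arcs G \<Longrightarrow> s \<in> {0..<1} \<Longrightarrow> left_translation_fun G t x i s = y i s"
  shows "left_translation G \<rho> t (L1_rel G \<rho> `` {x}) = L1_rel G \<rho> `` {y}"
proof -
  have "(left_translation_fun G t f, y) \<in> L1_rel G \<rho>" if "(x, f) \<in> L1_rel G \<rho>" for f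
  proof -
    have "AE s in unit_leb. \<forall>j \<in> arcs G. x j s = f j s"
      using that by (subst AE_ball_countable[OF countable_arcs]) (auto simp: L1_rel_def)
    then have rot: "AE s in unit_leb. \<forall>j \<in> arcs G. x j (rotation t s) = f j (rotation t s)"
      by (rule AE_rotation)
    have eq: "AE s in unit_leb. y i s = left_translation_fun G t f i s" if i: "i \<in> arcs G" for i
      using rot AE_space
    proof eventually_elim
      case (elim s)
      then have s: "s \<in> {0..<1}"
        by simp
      have "left_translation_fun G t x i s = left_translation_fun G t f i s"
        unfolding left_translation_fun_def shift_pos_eq[OF t, of s]
        using elim(1) s t descendants_subset[OF i] by (intro infsum_cong) (auto simp: shift_pos_eq)
      with xy[OF i s] show ?case
        by simp
    qed
    have "measurable_family (left_translation_fun G t f)"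
      unfolding measurable_family_def
    proof
      fix i assume i: "i \<in> arcs G"
      show "left_translation_fun G t f i \<in> borel_measurable unit_leb"
        by (rule measurable_unit_leb_AE[OF _ eq[OF i]]) (use y i in \<open>auto simp: L1_fun_def\<close>)
    qed
    moreover have "L1_norm G \<rho> (left_translation_fun G t f) = L1_norm G \<rho> y"
    proof (rule L1_norm_cong_AE)
      show "AE s in unit_leb. norm (left_translation_fun G t f i s) = norm (y i s)" if "i \<in> arcs G" for i
        using eq[OF that] by eventually_elim simp
    qed
    ultimately have "left_translation_fun G t f \<in> L1_fun G \<rho>"
      using y by (simp add: L1_fun_iff)
    moreover have "AE s in unit_leb. left_translation_fun G t f i s = y i s" if "i \<in> arcs G" for i
      using eq[OF that] by eventually_elim simp
    ultimately show ?thesis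
      using y by (simp add: L1_rel_def)
  qed
  then have "L1_rel G \<rho> `` {left_translation_fun G t f} = L1_rel G \<rho> `` {y}" if "(x, f) \<in> L1_rel G \<rho>" for f
    using that equiv_class_eq[OF equiv_L1_rel] by blast
  moreover have "x \<in> L1_rel G \<rho> `` {x}"
    using x by (rule L1_class_self)
  ultimately show ?thesis
    unfolding left_translation_def by auto
qed

text \<open>Each radius is halved: one half pays for truncating the centre, the other for
  \<open>h\<close> in the case of \<open>U\<close> and for cutting \<open>v\<close> off outside
  \<open>E\<close> in the case of \<open>V\<close>. All four parameters are fixed before t.\<close>

lemma hitting_times_supset_N1:
  fixes U V :: "('i \<Rightarrow> real \<Rightarrow> 'k::euclidean_space) set set"
  assumes "rooted G" "leafless G"
    and U: "openin (L1_topology G \<rho>) U" "U \<noteq> {}" and V: "openin (L1_topology G \<rho>) V" "V \<noteq> {}"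
  obtains K \<epsilon> \<alpha> R where "finite K" "K \<noteq> {}" "K \<subseteq> arcs G" "0 < \<epsilon>" "0 < \<alpha>" "\<alpha> < 1" "0 < R"
    "N1 G \<rho> K \<epsilon> \<alpha> \<inter> {R<..} \<subseteq> hitting_times (left_translation G \<rho>) U V"
proof -
  obtain fu ru where fu: "fu \<in> L1_fun G \<rho>" and ru: "0 < ru"
    and ballU: "\<And>g. g \<in> L1_fun G \<rho> \<Longrightarrow> L1_norm G \<rho> (\<lambda>i s. fu i s - g i s) < ennreal ru \<Longrightarrow>
      L1_rel G \<rho> `` {g} \<in> U"
    using openin_L1_topology_ball[OF U] by blast
  obtain fv rv where fv: "fv \<in> L1_fun G \<rho>" and rv: "0 < rv"
    and ballV: "\<And>g. g \<in> L1_fun G \<rho> \<Longrightarrow> L1_norm G \<rho> (\<lambda>i s. fv i s - g i s) < ennreal rv \<Longrightarrow>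
      L1_rel G \<rho> `` {g} \<in> V"
    using openin_L1_topology_ball[OF V] by blast
  obtain u Ku cu where u: "u \<in> L1_fun G \<rho>" "finite Ku" "Ku \<subseteq> arcs G" and "0 < cu"
    and u_off: "\<And>i s. i \<notin> Ku \<Longrightarrow> u i s = 0" and "\<And>i s. norm (u i s) \<le> cu"
    "\<And>i s. norm (u i s) * \<rho> i s \<le> cu"
    and fu_u: "L1_norm G \<rho> (\<lambda>i s. fu i s - u i s) < ennreal (ru / 2)"
    using L1_fun_approx[OF fu half_gt_zero[OF ru]] by blast
  obtain v Kv c where v: "v \<in> L1_fun G \<rho>" "finite Kv" "Kv \<subseteq> arcs G" and c0: "0 < c"
    and v_off: "\<And>i s. i \<notin> Kv \<Longrightarrow> v i s = 0" and v_le: "\<And>i s. norm (v i s) \<le> c"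
    and v_le': "\<And>i s. norm (v i s) * \<rho> i s \<le> c"
    and fv_v: "L1_norm G \<rho> (\<lambda>i s. fv i s - v i s) < ennreal (rv / 2)"
    using L1_fun_approx[OF fv half_gt_zero[OF rv]] by blast
  note c = c0 v_le v_le'
  \<comment> \<open>Both truncations may have empty support, whereas \<open>K\<close> has to be
    nonempty.\<close>
  obtain i0 where i0: "i0 \<in> arcs G"
  proof -
    obtain r where "r \<in> verts G"
      using \<open>rooted G\<close> by (auto simp: rooted_def is_root_def)
    then obtain x where "r \<rightarrow>\<^bsub>G\<^esub> x"
      using \<open>leafless G\<close> by (auto simp: leafless_def is_leaf_def)
    then show ?thesis
      using that by (auto simp: arcs_ends_def)
  qed
  define K where "K = insert i0 (Ku \<union> Kv)"
  have K: "finite K" "K \<noteq> {}" "K \<subseteq> arcs G"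
    using u v i0 by (auto simp: K_def)
  define m where "m = real (card K)"
  have m: "0 < m"
    using K by (simp add: m_def card_gt_0_iff)
  \<comment> \<open>The permitted measure of the complement of \<open>E\<close>, so that \<alpha> =
    1 - a. Each of the m edges loses at most c a, in total at most rv / 2; the minimum with 1/2
    keeps \<alpha> positive.\<close>
  define a where "a = min (1 / 2) (rv / (2 * c * m))"
  have a: "0 < a" "a < 1" "m * c * a \<le> rv / 2"
  proof -
    show "0 < a"
      using rv c m by (simp add: a_def)
    show "a < 1"
      by (simp add: a_def)
    have "m * c * a \<le> m * c * (rv / (2 * c * m))"
      unfolding a_def using c m by (intro mult_left_mono min.cobounded2) simp
    also have "\<dots> = rv / 2"
      using c m by simp
    finally show "m * c * a \<le> rv / 2" .
  qed
  \<comment> \<open>The infima on \<open>E\<close> and the slack of m edges each cost at most ru / 4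
    after multiplication by the bound c of \<open>v\<close>.\<close>
  define \<epsilon> where "\<epsilon> = ru / (4 * c)"
  define \<eta> where "\<eta> = ru / (4 * c * m)"
  have \<epsilon>: "0 < \<epsilon>" "0 < \<eta>" "c * (\<epsilon> + m * \<eta>) = ru / 2"
    using ru c m by (simp_all add: \<epsilon>_def \<eta>_def field_simps)
  obtain N where N: "\<And>n i k. N \<le> n \<Longrightarrow> i \<in> arcs G \<Longrightarrow> k \<in> K \<Longrightarrow> k \<notin> descendants G n i"
    using eventually_not_descendants[OF \<open>rooted G\<close> K(1,3)] by blast
  have halves: "p + q < ennreal r" if "p < ennreal (r / 2)" "q \<le> ennreal (r / 2)" for p q r
  proof -
    have "p + q < ennreal (r / 2) + ennreal (r / 2)"
      using that by (cases p; cases q) (auto simp: ennreal_less_iff top_unique simp flip: ennreal_plus)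
    also have "\<dots> = ennreal r"
      by (cases "0 \<le> r") (auto simp: ennreal_neg simp flip: ennreal_plus)
    finally show ?thesis .
  qed
  have "t \<in> hitting_times (left_translation G \<rho>) U V"
    if tN: "t \<in> N1 G \<rho> K \<epsilon> (1 - a)" and "real (Suc N) < t" for t
  proof -
    have t: "0 \<le> t" "real N \<le> t"
      using that by auto
    obtain E where E: "E \<in> sets unit_leb" "1 - a < measure lebesgue E"
      and int: "(\<integral>\<^sup>+ s \<in> E. (\<Sum>i \<in> K. inf_weight G \<rho> i t s) \<partial>lebesgue) < ennreal \<epsilon>"
      using tN by (auto simp: N1_def INF_less_iff sets_unit_leb)
    have off: "\<forall>i \<in> arcs G. \<forall>s \<in> {0..<1}. descendants G (shift_index t s) i \<inter> K = {}"
      using N shift_index_ge[of t _ N] t by fastforce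
    have u0: "\<forall>i s. i \<notin> K \<longrightarrow> u i s = 0" and v0: "\<forall>i s. i \<notin> K \<longrightarrow> v i s = 0"
      using u_off v_off by (auto simp: K_def)
    have mv: "measurable_family v"
      using v(1) by (simp add: L1_fun_iff)
    obtain h where h: "measurable_family h"
      "L1_norm G \<rho> h \<le> ennreal c *
        ((\<integral>\<^sup>+ s \<in> E. (\<Sum>i \<in> K. inf_weight G \<rho> i t s) \<partial>lebesgue) + ennreal (real (card K) * \<eta>))"
      "\<And>i s. i \<in> arcs G \<Longrightarrow> s \<in> {0..<1} \<Longrightarrow>
        left_translation_fun G t (\<lambda>j s. u j s + h j s) i s = (if s \<in> E then v i s else 0)"
      using transport_along_descendants[OF \<open>leafless G\<close> K u0 mv v0 c(2) t(1) E(1) \<epsilon>(2) off]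
      by blast
    note h(2)
    also have "ennreal c * ((\<integral>\<^sup>+ s \<in> E. (\<Sum>i \<in> K. inf_weight G \<rho> i t s) \<partial>lebesgue) + ennreal (real (card K) * \<eta>))
        \<le> ennreal c * (ennreal \<epsilon> + ennreal (m * \<eta>))"
      using int unfolding m_def by (intro mult_left_mono add_mono) auto
    also have "\<dots> = ennreal (c * (\<epsilon> + m * \<eta>))"
      using c m \<epsilon> by (simp add: ennreal_mult)
    finally have norm_h: "L1_norm G \<rho> h \<le> ennreal (ru / 2)"
      by (simp only: \<epsilon>(3))
    then have hL1: "h \<in> L1_fun G \<rho>"
      using h(1) by (auto simp: L1_fun_iff intro: le_less_trans)
    define x where "x = (\<lambda>i s. u i s + h i s)"
    define y where "y = (\<lambda>i s. if s \<in> E then v i s else 0)"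
    have x: "x \<in> L1_fun G \<rho>"
      unfolding x_def by (rule L1_fun_add[OF u(1) hL1])
    have "L1_norm G \<rho> (\<lambda>i s. fu i s - x i s)
        \<le> L1_norm G \<rho> (\<lambda>i s. fu i s - u i s) + L1_norm G \<rho> (\<lambda>i s. u i s - x i s)"
      using fu u x by (intro L1_norm_triangle) (auto simp: L1_fun_iff)
    also have "L1_norm G \<rho> (\<lambda>i s. u i s - x i s) = L1_norm G \<rho> h"
      by (rule L1_norm_cong_AE) (simp add: x_def)
    also have "L1_norm G \<rho> (\<lambda>i s. fu i s - u i s) + L1_norm G \<rho> h < ennreal ru"
      using fu_u norm_h by (rule halves)
    finally have xU: "L1_rel G \<rho> `` {x} \<in> U"
      by (rule ballU[OF x])
    have "{s \<in> space unit_leb. s \<in> E} = E"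
      using sets.sets_into_space[OF E(1)] by auto
    then have my: "measurable_family y"
      unfolding measurable_family_def y_def
      using E(1) mv by (intro ballI measurable_If measurable_familyD[of v]) simp_all
    have "L1_norm G \<rho> y \<le> L1_norm G \<rho> v"
      by (rule L1_norm_mono) (simp add: y_def)
    then have y: "y \<in> L1_fun G \<rho>"
      using my v(1) by (auto simp: L1_fun_iff intro: le_less_trans)
    have "L1_norm G \<rho> (\<lambda>i s. v i s - y i s)
        = (\<Sum>i\<in>K. \<integral>\<^sup>+ s. ennreal (norm (v i s - y i s) * \<rho> i s) \<partial>unit_leb)"
      using K v0 by (intro L1_norm_finite_support) (auto simp: y_def)
    also have "\<dots> \<le> (\<Sum>i\<in>K. ennreal (c * a))"
    proof (rule sum_mono)
      \<comment> \<open>The weighted truncation bound makes the integrand at most c, and it vanishes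
        on \<open>E\<close>.\<close>
      fix i assume "i \<in> K"
      have "(\<integral>\<^sup>+ s. ennreal (norm (v i s - y i s) * \<rho> i s) \<partial>unit_leb)
          \<le> (\<integral>\<^sup>+ s. ennreal c * indicator ({0..<1} - E) s \<partial>unit_leb)"
        using c(3) by (intro nn_integral_mono) (auto simp: y_def split: split_indicator intro!: ennreal_leI)
      also have "\<dots> = ennreal c * emeasure unit_leb ({0..<1} - E)"
        using sets.compl_sets[OF E(1)] by (intro nn_integral_cmult_indicator) simp
      also have "emeasure unit_leb ({0..<1} - E) = ennreal (measure unit_leb ({0..<1} - E))"
        by (rule finite_measure.emeasure_eq_measure[OF finite_measure_unit_leb])
      also have "measure unit_leb ({0..<1} - E) = 1 - measure lebesgue E"
        using E(1) by (simp only: measure_unit_leb_Compl measure_unit_leb)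
      also have "ennreal c * ennreal (1 - measure lebesgue E) \<le> ennreal c * ennreal a"
        using E(2) by (intro mult_left_mono ennreal_leI) auto
      also have "\<dots> = ennreal (c * a)"
        using c a by (simp add: ennreal_mult)
      finally show "(\<integral>\<^sup>+ s. ennreal (norm (v i s - y i s) * \<rho> i s) \<partial>unit_leb) \<le> ennreal (c * a)" .
    qed
    also have "\<dots> = ennreal (m * c * a)"
      using c a by (simp add: m_def ennreal_mult ennreal_of_nat_eq_real_of_nat mult_ac)
    also have "\<dots> \<le> ennreal (rv / 2)"
      using a(3) by (rule ennreal_leI)
    finally have vy: "L1_norm G \<rho> (\<lambda>i s. v i s - y i s) \<le> ennreal (rv / 2)" .
    have "L1_norm G \<rho> (\<lambda>i s. fv i s - y i s)
        \<le> L1_norm G \<rho> (\<lambda>i s. fv i s - v i s) + L1_norm G \<rho> (\<lambda>i s. v i s - y i s)"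
      using fv v y by (intro L1_norm_triangle) (auto simp: L1_fun_iff)
    also have "\<dots> < ennreal rv"
      using fv_v vy by (rule halves)
    finally have yV: "L1_rel G \<rho> `` {y} \<in> V"
      by (rule ballV[OF y])
    have "left_translation G \<rho> t (L1_rel G \<rho> `` {x}) = L1_rel G \<rho> `` {y}"
      using h(3) by (intro left_translation_class t x y) (simp add: x_def y_def)
    with xU yV t show ?thesis
      by (auto simp: hitting_times_def)
  qed
  with K \<epsilon> a show ?thesis
    by (intro that[of K \<epsilon> "1 - a" "real (Suc N)"]) auto
qed

section \<open>From recurrence to small weights\<close>

lemma L1_norm_sum_le:
  assumes "finite K" "K \<subseteq> arcs G"
  shows "(\<Sum>i\<in>K. \<integral>\<^sup>+ s. ennreal (norm (f i s) * \<rho> i s) \<partial>unit_leb) \<le> L1_norm G \<rho> f"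
  unfolding L1_norm_def using assms
  by (subst nn_integral_count_space_finite[symmetric]) (auto intro!: nn_integral_count_space_mono_subset)

lemma indicator_L1_fun:
  assumes K: "finite K" "K \<subseteq> arcs G"
  shows "(\<lambda>i s. if i \<in> K then 1 else 0 :: 'k::{real_normed_field, euclidean_space}) \<in> L1_fun G \<rho>"
proof -
  have "L1_norm G \<rho> (\<lambda>i s. if i \<in> K then 1 else 0 :: 'k) = (\<Sum>i\<in>K. \<integral>\<^sup>+ s. ennreal (\<rho> i s) \<partial>unit_leb)"
    using K by (subst L1_norm_finite_support[of K]) auto
  also have "\<dots> < \<infinity>"
  proof -
    have "(\<integral>\<^sup>+ s. ennreal (\<rho> i s) \<partial>unit_leb) < \<infinity>" if "i \<in> K" for i
    proof -
      have "integrable unit_leb (\<rho> i)"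
        using weight K that by (auto simp: weight_def)
      moreover have "AE s in unit_leb. 0 \<le> \<rho> i s"
        by (rule AE_I2) (use weight_pos[of i] K that in \<open>auto intro: less_imp_le\<close>)
      ultimately show ?thesis
        by (subst nn_integral_eq_integral) auto
    qed
    then show ?thesis
      using K by (simp add: less_top)
  qed
  finally show ?thesis
    by (simp add: L1_fun_iff measurable_family_def)
qed

text \<open>A member of \<open>L1_space\<close> is nonempty, so at least one representative of
  \<open>A\<close> contributes to the union, and the estimates can be run with that one.\<close>

lemma left_translation_representative:
  fixes A :: "('i \<Rightarrow> real \<Rightarrow> 'k::real_normed_vector) set"
  assumes "left_translation G \<rho> t A \<in> L1_space G \<rho>"
  obtains g where "g \<in> A" "left_translation_fun G t g \<in> L1_fun G \<rho>"
    "left_translation_fun G t g \<in> left_translation G \<rho> t A"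
proof -
  obtain b where "b \<in> left_translation G \<rho> t A"
    using assms by (rule L1_space_representative)
  then obtain g where g: "g \<in> A" "(left_translation_fun G t g, b) \<in> L1_rel G \<rho>"
    by (auto simp: left_translation_def)
  then have "left_translation_fun G t g \<in> L1_fun G \<rho>"
    by (simp add: L1_rel_def)
  with g(1) L1_class_self[OF this] show ?thesis
    by (intro that[of g]) (auto simp: left_translation_def)
qed

text \<open>If \<open>g\<close> and \<open>T\<^sub>t g\<close> are both close to the indicator of \<open>K\<close>, then off \<open>K\<close>, where the descendants of
  \<open>K\<close> lie, \<open>g\<close> has small norm, although its values on the descendants of each edge of \<open>K\<close> add up to
  at least one half on a large set of positions: the weights there must be small.\<close>

lemma return_times_of_indicator:
  assumes "rooted G" and K: "finite K" "K \<subseteq> arcs G"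
    and pos: "0 < \<epsilon>" "\<alpha> < 1"
  obtains U :: "('i \<Rightarrow> real \<Rightarrow> 'k::{real_normed_field, euclidean_space}) set set" and R
  where "openin (L1_topology G \<rho>) U" "U \<noteq> {}" "0 < R"
    "hitting_times (left_translation G \<rho>) U U \<inter> {R<..} \<subseteq> N1 G \<rho> K \<epsilon> \<alpha>"
proof -
  interpret finite_measure unit_leb
    by (rule finite_measure_unit_leb)
  define f where "f = (\<lambda>i s::real. if i \<in> K then 1 else 0 :: 'k)"
  have f: "f \<in> L1_fun G \<rho>"
    unfolding f_def by (rule indicator_L1_fun[OF K])
  \<comment> \<open>A floor for the weights, bought with half of the measure 1 - \<alpha> that may
    be discarded.\<close>
  obtain c where c: "0 < c" and small: "measure unit_leb {s \<in> {0..<1}. \<exists>i \<in> K. \<rho> i s < c} < (1 - \<alpha>) / 2"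
    using measure_small_weight[OF K, of "(1 - \<alpha>) / 2"] pos by auto
  obtain N where N: "\<And>n i k. N \<le> n \<Longrightarrow> i \<in> arcs G \<Longrightarrow> k \<in> K \<Longrightarrow> k \<notin> descendants G n i"
    using eventually_not_descendants[OF \<open>rooted G\<close> K] by blast
  \<comment> \<open>The first bound lets Markov's inequality use at most the other half of 1 -
    \<alpha>. The second keeps the final estimate below \<epsilon>; the added 1 makes the
    denominator positive and the inequality strict.\<close>
  define \<delta> where "\<delta> = min (c * (1 - \<alpha>) / 4) (\<epsilon> / (2 * real (card K) + 1))"
  have \<delta>: "0 < \<delta>" "2 / c * \<delta> \<le> (1 - \<alpha>) / 2" "2 * real (card K) * \<delta> < \<epsilon>"
  proof -
    show "0 < \<delta>"
      using c pos by (simp add: \<delta>_def)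
    have "\<delta> \<le> c * (1 - \<alpha>) / 4"
      unfolding \<delta>_def by (rule min.cobounded1)
    then show "2 / c * \<delta> \<le> (1 - \<alpha>) / 2"
      using c by (simp add: field_simps)
    have "(2 * real (card K) + 1) * \<delta> \<le> (2 * real (card K) + 1) * (\<epsilon> / (2 * real (card K) + 1))"
      unfolding \<delta>_def by (intro mult_left_mono min.cobounded2) simp
    also have "\<dots> = \<epsilon>"
      by simp
    finally show "2 * real (card K) * \<delta> < \<epsilon>"
      using \<open>0 < \<delta>\<close> by (simp add: algebra_simps)
  qed
  define F where "F = L1_rel G \<rho> `` {f}"
  have F: "F \<in> L1_space G \<rho>" "f \<in> F"
    unfolding F_def using L1_class_in[OF f] L1_class_self[OF f] by blast+
  define U where "U = L1.mball F \<delta>"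
  have "t \<in> N1 G \<rho> K \<epsilon> \<alpha>"
    if hit: "t \<in> hitting_times (left_translation G \<rho>) U U" and t: "real (Suc N) < t" for t
  proof -
    have t0: "0 \<le> t"
      using t by simp
    obtain A where A: "A \<in> U" "left_translation G \<rho> t A \<in> U"
      using hit by (auto simp: hitting_times_def)
    then have A': "A \<in> L1_space G \<rho>" "left_translation G \<rho> t A \<in> L1_space G \<rho>"
      by (auto simp: U_def)
    obtain g where g: "g \<in> A" "left_translation_fun G t g \<in> L1_fun G \<rho>"
      "left_translation_fun G t g \<in> left_translation G \<rho> t A"
      using A'(2) by (rule left_translation_representative)
    define T where "T = left_translation_fun G t g"
    have fg: "L1_norm G \<rho> (\<lambda>i s. f i s - g i s) < ennreal \<delta>"
      using A(1) L1_dist_less_iff[OF F(1) A'(1) F(2) g(1)] by (simp add: U_def)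
    have fT: "L1_norm G \<rho> (\<lambda>i s. f i s - T i s) < ennreal \<delta>"
      using A(2) L1_dist_less_iff[OF F(1) A'(2) F(2) g(3)] by (simp add: U_def T_def)
    have mg: "measurable_family g"
      using g(1) A'(1) L1_space_subset L1_fun_iff by blast
    have mfT: "measurable_family (\<lambda>i s. f i s - T i s)"
      using f g(2) by (intro measurable_family_diff) (simp_all add: L1_fun_iff T_def)
    define Z where "Z s = (\<Sum>i\<in>K. ennreal (norm (f i s - T i s) * \<rho> i s))" for s
    have mZ: "Z \<in> borel_measurable unit_leb"
      unfolding Z_def using K by (intro borel_measurable_sum density_measurable[OF mfT]) auto
    define B1 where "B1 = {s \<in> {0..<1}. \<exists>i \<in> K. \<rho> i s < c}"
    \<comment> \<open>The level c / 2 is what one edge alone contributes to \<open>Z\<close> when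
      its weight is at least c and \<open>T\<close> differs from 1 by at least 1/2. The form with 2
      / c suits Markov's inequality.\<close>
    define B2 where "B2 = {s \<in> space unit_leb. 1 \<le> ennreal (2 / c) * Z s}"
    have mB2: "B2 \<in> sets unit_leb"
      unfolding B2_def using mZ by measurable
    have mB1: "B1 \<in> sets unit_leb"
    proof -
      have "B1 = (\<Union>i\<in>K. \<rho> i -` {..<c} \<inter> space unit_leb)"
        by (auto simp: B1_def)
      also have "\<dots> \<in> sets unit_leb"
        using K by (intro sets.finite_UN measurable_sets[of _ _ borel] weight_measurable) auto
      finally show ?thesis .
    qed
    have "(\<integral>\<^sup>+ s. Z s \<partial>unit_leb) = (\<Sum>i\<in>K. \<integral>\<^sup>+ s. ennreal (norm (f i s - T i s) * \<rho> i s) \<partial>unit_leb)"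
      unfolding Z_def using K by (intro nn_integral_sum density_measurable[OF mfT]) auto
    also have "\<dots> \<le> L1_norm G \<rho> (\<lambda>i s. f i s - T i s)"
      by (rule L1_norm_sum_le[OF K])
    finally have Z: "(\<integral>\<^sup>+ s. Z s \<partial>unit_leb) \<le> ennreal \<delta>"
      using fT by simp
    have "emeasure unit_leb B2 \<le> ennreal (2 / c) * (\<integral>\<^sup>+ s. Z s * indicator (space unit_leb) s \<partial>unit_leb)"
      unfolding B2_def using mZ
      by (intro nn_integral_Markov_inequality borel_measurable_times_ennreal borel_measurable_indicator sets.top)
    also have "(\<integral>\<^sup>+ s. Z s * indicator (space unit_leb) s \<partial>unit_leb) = (\<integral>\<^sup>+ s. Z s \<partial>unit_leb)"
      by (rule nn_integral_cong) simp
    also have "ennreal (2 / c) * (\<integral>\<^sup>+ s. Z s \<partial>unit_leb) \<le> ennreal (2 / c) * ennreal \<delta>"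
      by (intro mult_left_mono Z) simp
    also have "\<dots> = ennreal (2 / c * \<delta>)"
      using c \<delta>(1) by (intro ennreal_mult[symmetric]) auto
    finally have "emeasure unit_leb B2 \<le> ennreal (2 / c * \<delta>)" .
    then have "measure unit_leb B2 \<le> 2 / c * \<delta>"
      using c \<delta> by (simp add: emeasure_eq_measure)
    then have B12: "measure unit_leb (B1 \<union> B2) < 1 - \<alpha>"
      using measure_Un_le[OF mB1 mB2] small \<delta>(2) unfolding B1_def[symmetric] by argo
    define E where "E = {0..<1} - (B1 \<union> B2)"
    have E: "E \<in> sets unit_leb"
      using sets.compl_sets[of "B1 \<union> B2" unit_leb] mB1 mB2 by (auto simp: E_def)
    have mE: "measure lebesgue E > \<alpha>"
      using measure_unit_leb[OF E] measure_unit_leb_Compl[of "B1 \<union> B2"] mB1 mB2 B12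
      by (auto simp: E_def)
    have half: "1 / 2 \<le> norm (T i s)" if "i \<in> K" "s \<in> E" for i s
    proof (rule ccontr)
      assume "\<not> 1 / 2 \<le> norm (T i s)"
      then have "1 / 2 \<le> norm (f i s - T i s)"
        using \<open>i \<in> K\<close> norm_triangle_ineq2[of "f i s" "T i s"] by (simp add: f_def)
      moreover have "c \<le> \<rho> i s"
        using that by (auto simp: E_def B1_def)
      ultimately have "1 / 2 * c \<le> norm (f i s - T i s) * \<rho> i s"
        using c by (intro mult_mono) auto
      then have "ennreal (1 / 2 * c) \<le> ennreal (norm (f i s - T i s) * \<rho> i s)"
        by (rule ennreal_leI)
      also have "\<dots> \<le> Z s"
        unfolding Z_def using K \<open>i \<in> K\<close> by (intro member_le_sum) auto
      finally have "ennreal (2 / c) * ennreal (1 / 2 * c) \<le> ennreal (2 / c) * Z s"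
        by (rule mult_left_mono) simp
      moreover have "ennreal (2 / c) * ennreal (1 / 2 * c) = 1"
        using c by (subst ennreal_mult[symmetric]) auto
      ultimately have "s \<in> B2"
        using that by (auto simp: B2_def E_def)
      then show False
        using that by (simp add: E_def)
    qed
    define H where "H i s = (\<integral>\<^sup>+ j. ennreal (norm (g j (rotation t s)) * \<rho> j (rotation t s))
      \<partial>count_space (descendants G (shift_index t s) i))" for i s
    have H: "(\<integral>\<^sup>+ s. H i s \<partial>unit_leb) \<le> ennreal \<delta>" if "i \<in> K" for i
    proof -
      have "(\<integral>\<^sup>+ s. H i s \<partial>unit_leb) \<le> L1_norm G \<rho> (\<lambda>j s. if j \<in> K then 0 else g j s)"
        unfolding H_def
      proof (rule rotated_L1_norm_le[OF mg])
        fix s :: real assume "s \<in> {0..<1}"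
        then have "N \<le> shift_index t s"
          using t t0 by (intro shift_index_ge) auto
        with N[of "shift_index t s" i] that K(2) show "descendants G (shift_index t s) i \<inter> K = {}"
          by auto
      qed (use that K in auto)
      \<comment> \<open>Off \<open>K\<close> the function \<open>f\<close> is 0, so there
        \<open>g\<close> is, up to sign, its own deviation from \<open>f\<close>.\<close>
      also have "\<dots> \<le> L1_norm G \<rho> (\<lambda>i s. f i s - g i s)"
        by (rule L1_norm_mono) (simp add: f_def)
      finally show ?thesis
        using fg by simp
    qed
    have halves: "2 * (x / 2) = x" for x :: ennreal
      by (simp add: ennreal_times_divide mult.commute[of 2] mult_divide_eq_ennreal)
    have "(\<integral>\<^sup>+ s \<in> E. (\<Sum>i \<in> K. inf_weight G \<rho> i t s) \<partial>lebesgue)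
        = (\<integral>\<^sup>+ s. (\<Sum>i \<in> K. inf_weight G \<rho> i t s * indicator E s) \<partial>unit_leb)"
      unfolding nn_integral_unit_leb by (rule nn_integral_cong) (auto simp: E_def sum_distrib_right split: split_indicator)
    also have "\<dots> = (\<Sum>i \<in> K. \<integral>\<^sup>+ s. inf_weight G \<rho> i t s * indicator E s \<partial>unit_leb)"
      using K E t0 by (intro nn_integral_sum borel_measurable_times_ennreal inf_weight_measurable) auto
    also have "\<dots> \<le> (\<Sum>i \<in> K. ennreal (2 * \<delta>))"
    proof (rule sum_mono)
      fix i assume i: "i \<in> K"
      have *: "inf_weight G \<rho> i t s * indicator E s \<le> 2 * H i s" if "s \<in> space unit_leb" for s
        using that i K half[OF i, of s] inf_weight_le[OF t0 _ _, of s i g]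
        by (auto simp: H_def T_def split: split_indicator)
      \<comment> \<open>Moving a factor across the integral takes measurability, which is at hand
        for \<open>inf_weight\<close> but has not been shown for \<open>H i\<close>. The 2 is
        therefore divided out on the left.\<close>
      have "(\<integral>\<^sup>+ s. inf_weight G \<rho> i t s * indicator E s \<partial>unit_leb) / 2 \<le> (\<integral>\<^sup>+ s. H i s \<partial>unit_leb)"
      proof -
        have "(\<integral>\<^sup>+ s. inf_weight G \<rho> i t s * indicator E s \<partial>unit_leb) / 2
            = (\<integral>\<^sup>+ s. inf_weight G \<rho> i t s * indicator E s / 2 \<partial>unit_leb)"
          using E i K t0 by (intro nn_integral_divide[symmetric] borel_measurable_times_ennreal inf_weight_measurable) auto
        also have "\<dots> \<le> (\<integral>\<^sup>+ s. H i s \<partial>unit_leb)"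
          by (intro nn_integral_mono divide_le_posI_ennreal *) auto
        finally show ?thesis .
      qed
      also have "\<dots> \<le> ennreal \<delta>"
        by (rule H[OF i])
      finally have "2 * ((\<integral>\<^sup>+ s. inf_weight G \<rho> i t s * indicator E s \<partial>unit_leb) / 2) \<le> 2 * ennreal \<delta>"
        by (rule mult_left_mono) simp
      then show "(\<integral>\<^sup>+ s. inf_weight G \<rho> i t s * indicator E s \<partial>unit_leb) \<le> ennreal (2 * \<delta>)"
        using \<delta> by (simp only: halves) (simp add: ennreal_mult)
    qed
    also have "\<dots> = ennreal (2 * real (card K) * \<delta>)"
      using \<delta> by (simp add: ennreal_mult ennreal_of_nat_eq_real_of_nat mult_ac)
    also have "\<dots> < ennreal \<epsilon>"
      using \<delta> by (intro ennreal_lessI) (use pos in auto)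
    finally have "(\<integral>\<^sup>+ s \<in> E. (\<Sum>i \<in> K. inf_weight G \<rho> i t s) \<partial>lebesgue) < ennreal \<epsilon>" .
    then show ?thesis
      unfolding N1_def using t0 E mE by (auto simp: INF_less_iff sets_unit_leb intro!: bexI[of _ E])
  qed
  moreover have "openin (L1_topology G \<rho>) U"
    unfolding U_def L1_topology_def by (rule L1.openin_mball)
  moreover have "U \<noteq> {}"
    using F \<delta> by (auto simp: U_def)
  ultimately show ?thesis
    by (intro that[of U "real (Suc N)"]) auto
qed

end

section \<open>A cycle of implications: recurrence, small weights, transitivity, recurrence\<close>

theorem corollary3p4:
  fixes G :: "('v, 'i) pre_digraph"
    and \<rho> :: "'i \<Rightarrow> real \<Rightarrow> real"
    and \<F> :: "real set set"
    and X :: "('i \<Rightarrow> real \<Rightarrow> 'k::{real_normed_field, euclidean_space}) set topology"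
  defines "X \<equiv> L1_topology G \<rho>"
  assumes "directed_tree G" and "rooted G" and "leafless G"
    and "weight G \<rho>" and "admissible1 G \<rho>"
    and "furstenberg_family \<F>" and "proper_family \<F>" and "finite_invariant \<F>"
  shows "(family_transitive \<F> X (left_translation G \<rho>) \<longleftrightarrow>
          (\<forall>K \<epsilon> \<alpha>. finite K \<and> K \<noteq> {} \<and> K \<subseteq> arcs G \<and> 0 < \<epsilon> \<and> 0 < \<alpha> \<and> \<alpha> < 1 \<longrightarrow>
            N1 G \<rho> K \<epsilon> \<alpha> \<in> \<F>)) \<and>
         ((\<forall>K \<epsilon> \<alpha>. finite K \<and> K \<noteq> {} \<and> K \<subseteq> arcs G \<and> 0 < \<epsilon> \<and> 0 < \<alpha> \<and> \<alpha> < 1 \<longrightarrow>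
            N1 G \<rho> K \<epsilon> \<alpha> \<in> \<F>) \<longleftrightarrow>
          family_recurrent \<F> X (left_translation G \<rho>))"
proof -
  interpret directed_tree G
    by fact
  interpret weighted_tree G \<rho>
    by unfold_locales (use \<open>weight G \<rho>\<close> countable_arcs in auto)
  let ?N1 = "\<forall>K \<epsilon> \<alpha>. finite K \<and> K \<noteq> {} \<and> K \<subseteq> arcs G \<and> 0 < \<epsilon> \<and> 0 < \<alpha> \<and> \<alpha> < 1 \<longrightarrow> N1 G \<rho> K \<epsilon> \<alpha> \<in> \<F>"
  \<comment> \<open>Finite invariance followed by upward closure: an inclusion valid only beyond R
    already transfers membership in the family.\<close>
  have up: "B \<in> \<F>" if "A \<in> \<F>" "A \<inter> {R<..} \<subseteq> B" "0 < R" "B \<subseteq> {0..}" for A B R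
  proof -
    have "A \<inter> {R<..} \<in> \<F>"
      using \<open>finite_invariant \<F>\<close> that by (simp add: finite_invariant_def)
    then show ?thesis
      using \<open>furstenberg_family \<F>\<close> that by (simp add: furstenberg_family_def)
  qed
  have "?N1" if rec: "family_recurrent \<F> X (left_translation G \<rho>)"
  proof (intro allI impI)
    fix K and \<epsilon> \<alpha> :: real
    assume "finite K \<and> K \<noteq> {} \<and> K \<subseteq> arcs G \<and> 0 < \<epsilon> \<and> 0 < \<alpha> \<and> \<alpha> < 1"
    then have K: "finite K" "K \<subseteq> arcs G" "0 < \<epsilon>" "\<alpha> < 1"
      by simp_all
    obtain U :: "('i \<Rightarrow> real \<Rightarrow> 'k) set set" and R where U: "openin (L1_topology G \<rho>) U" "U \<noteq> {}"
      and R: "0 < R" "hitting_times (left_translation G \<rho>) U U \<inter> {R<..} \<subseteq> N1 G \<rho> K \<epsilon> \<alpha>"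
      \<comment> \<open>\<open>N1\<close> does not mention the scalars, so the scalar type is fixed
        to that of the given space.\<close>
      by (rule return_times_of_indicator[where 'k = 'k, OF \<open>rooted G\<close> K])
    have "hitting_times (left_translation G \<rho>) U U \<in> \<F>"
      using rec U by (simp add: family_recurrent_def X_def)
    moreover have "N1 G \<rho> K \<epsilon> \<alpha> \<subseteq> {0..}"
      unfolding N1_def by auto
    ultimately show "N1 G \<rho> K \<epsilon> \<alpha> \<in> \<F>"
      by (rule up[OF _ R(2,1)])
  qed
  moreover have "family_transitive \<F> X (left_translation G \<rho>)" if N1: ?N1
    unfolding family_transitive_def X_def
  proof (intro allI impI)
    fix U V :: "('i \<Rightarrow> real \<Rightarrow> 'k) set set"
    assume "openin (L1_topology G \<rho>) U \<and> U \<noteq> {} \<and> openin (L1_topology G \<rho>) V \<and> V \<noteq> {}"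
    then have U: "openin (L1_topology G \<rho>) U" "U \<noteq> {}" and V: "openin (L1_topology G \<rho>) V" "V \<noteq> {}"
      by simp_all
    obtain K \<epsilon> \<alpha> R where K: "finite K" "K \<noteq> {}" "K \<subseteq> arcs G" "0 < \<epsilon>" "0 < \<alpha>" "\<alpha> < 1"
      and R: "0 < R" "N1 G \<rho> K \<epsilon> \<alpha> \<inter> {R<..} \<subseteq> hitting_times (left_translation G \<rho>) U V"
      by (rule hitting_times_supset_N1[OF \<open>rooted G\<close> \<open>leafless G\<close> U V])
    have "N1 G \<rho> K \<epsilon> \<alpha> \<in> \<F>"
      using N1 K by simp
    moreover have "hitting_times (left_translation G \<rho>) U V \<subseteq> {0..}"
      unfolding hitting_times_def by auto
    ultimately show "hitting_times (left_translation G \<rho>) U V \<in> \<F>"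
      by (rule up[OF _ R(2,1)])
  qed
  moreover have "family_recurrent \<F> X (left_translation G \<rho>)"
    if "family_transitive \<F> X (left_translation G \<rho>)"
    using that by (simp add: family_transitive_def family_recurrent_def)
  ultimately show ?thesis
    by blast
qed

end
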